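(* Let $1<p<\infty$, $p\neq 2$, and let $\mathbf{e}_{-1}(z):=z^{-1}$, $z\in\mathbb{T}$. Then the Toeplitz operator $T(\mathbf{e}_{-1}):H^p(\mathbb{T})\to H^p(\mathbb{T})$ satisfies $$\|T(\mathbf{e}_{-1})\|_{\mathrm{e}} > 1 = \|\mathbf{e}_{-1}\|_{L^\infty}.$$
   Context: $\mathbb{T}=\{z\in\mathbb{C}:|z|=1\}$; $\widehat f(k)=\frac1{2\pi}\int_{-\pi}^{\pi} f(e^{i\theta})e^{-ik\theta}\,d\theta$, $k\in\mathbb{Z}$. $H^p(\mathbb{T})=\{f\in L^p(\mathbb{T}):\widehat f(k)=0\text{ for all }k<0\}$ with the $L^p(\mathbb{T})$ norm. The Riesz projection $P$ sends $f=\sum_{k\in\mathbb{Z}}\widehat f(k)e^{ik\theta}$ to $\sum_{k\ge0}\widehat f(k)e^{ik\theta}$; it is bounded from $L^p(\mathbb{T})$ to $H^p(\mathbb{T})$ for $1<p<\infty$. For $a\in L^\infty(\mathbb{T})$, the Toeplitz operator is $T(a)f:=P(af)$, $f\in H^p(\mathbb{T})$. For a bounded linear operator $A:X\to Y$ between Banach spaces, the essential norm is $\|A\|_{\mathrm{e}}:=\inf\{\|A-K\|: K:X\to Y\text{ compact linear}\}$. *)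

theory Defs
  imports "HOL-Analysis.Analysis" "HOL-Probability.Essential_Supremum"
begin

section \<open>Function spaces on the unit circle\<close>

text \<open>Normalised arc length \<open>d\<theta> / 2\<pi>\<close>, as a measure whose space is the unit circle.\<close>

definition circle_measure :: "complex measure" where
  "circle_measure =
     distr (uniform_measure lborel {-pi..pi}) (restrict_space borel (sphere 0 1)) cis"

text \<open>Elements of \<open>L\<^sup>p\<close> are handled through representatives: \<open>Lp p\<close> is a set of functions and
  \<open>Lp_norm p\<close> a seminorm on it, whose null elements are the functions vanishing almost everywhere.
  The values of a function off the circle play no role.\<close>

definition Lp :: "real \<Rightarrow> (complex \<Rightarrow> complex) set" where
  "Lp p = {f \<in> borel_measurable circle_measure.
             integrable circle_measure (\<lambda>z. norm (f z) powr p)}"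

definition Lp_norm :: "real \<Rightarrow> (complex \<Rightarrow> complex) \<Rightarrow> real" where
  "Lp_norm p f = (LINT z|circle_measure. norm (f z) powr p) powr (1 / p)"

definition Linf_norm :: "(complex \<Rightarrow> complex) \<Rightarrow> ereal" where
  "Linf_norm f = esssup circle_measure (\<lambda>z. ereal (norm (f z)))"

definition fourier :: "(complex \<Rightarrow> complex) \<Rightarrow> int \<Rightarrow> complex" where
  "fourier f k = complex_of_real (1 / (2 * pi)) *
     (LINT \<theta>:{-pi..pi}|lborel. f (cis \<theta>) * exp (- \<i> * of_int k * of_real \<theta>))"

definition Hp :: "real \<Rightarrow> (complex \<Rightarrow> complex) set" where
  "Hp p = {f \<in> Lp p. \<forall>k<0. fourier f k = 0}"

text \<open>The function with Fourier series \<open>\<Sum>k\<ge>0. fourier f k z\<^sup>k\<close> is unique up to null sets, so the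
  choice below only selects a representative.\<close>

definition riesz_projection :: "real \<Rightarrow> (complex \<Rightarrow> complex) \<Rightarrow> complex \<Rightarrow> complex" where
  "riesz_projection p f = (SOME g. g \<in> Hp p \<and> (\<forall>k\<ge>0. fourier g k = fourier f k))"

definition toeplitz ::
  "real \<Rightarrow> (complex \<Rightarrow> complex) \<Rightarrow> (complex \<Rightarrow> complex) \<Rightarrow> complex \<Rightarrow> complex" where
  "toeplitz p a f = riesz_projection p (\<lambda>z. a z * f z)"

definition e_minus_one :: "complex \<Rightarrow> complex" where
  "e_minus_one z = z powi (-1)"


section \<open>Linear operators and the essential norm\<close>

text \<open>A normed space of functions modulo null functions is given by a set \<open>X\<close> of functions and a
  seminorm \<open>NX\<close> on it. A linear operator between two such quotients is represented by a map on
  representatives; equalities between values are taken modulo null functions. Every linear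
  operator on the quotients arises in this way.\<close>

definition linear_op ::
  "('a \<Rightarrow> complex) set \<Rightarrow> (('a \<Rightarrow> complex) \<Rightarrow> real) \<Rightarrow>
   ('b \<Rightarrow> complex) set \<Rightarrow> (('b \<Rightarrow> complex) \<Rightarrow> real) \<Rightarrow>
   (('a \<Rightarrow> complex) \<Rightarrow> 'b \<Rightarrow> complex) \<Rightarrow> bool" where
  "linear_op X NX Y NY A \<longleftrightarrow>
     (\<forall>f\<in>X. A f \<in> Y) \<and>
     (\<forall>f\<in>X. \<forall>g\<in>X. NX (\<lambda>x. f x - g x) = 0 \<longrightarrow> NY (\<lambda>y. A f y - A g y) = 0) \<and>
     (\<forall>f\<in>X. \<forall>g\<in>X. NY (\<lambda>y. A (\<lambda>x. f x + g x) y - (A f y + A g y)) = 0) \<and>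
     (\<forall>c. \<forall>f\<in>X. NY (\<lambda>y. A (\<lambda>x. c * f x) y - c * A f y) = 0)"

definition bounded_linear_op ::
  "('a \<Rightarrow> complex) set \<Rightarrow> (('a \<Rightarrow> complex) \<Rightarrow> real) \<Rightarrow>
   ('b \<Rightarrow> complex) set \<Rightarrow> (('b \<Rightarrow> complex) \<Rightarrow> real) \<Rightarrow>
   (('a \<Rightarrow> complex) \<Rightarrow> 'b \<Rightarrow> complex) \<Rightarrow> bool" where
  "bounded_linear_op X NX Y NY A \<longleftrightarrow>
     linear_op X NX Y NY A \<and> (\<exists>C. \<forall>f\<in>X. NY (A f) \<le> C * NX f)"

text \<open>The image of the closed unit ball is relatively compact in \<open>Y\<close>.\<close>

definition compact_linear_op ::
  "('a \<Rightarrow> complex) set \<Rightarrow> (('a \<Rightarrow> complex) \<Rightarrow> real) \<Rightarrow>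
   ('b \<Rightarrow> complex) set \<Rightarrow> (('b \<Rightarrow> complex) \<Rightarrow> real) \<Rightarrow>
   (('a \<Rightarrow> complex) \<Rightarrow> 'b \<Rightarrow> complex) \<Rightarrow> bool" where
  "compact_linear_op X NX Y NY K \<longleftrightarrow>
     linear_op X NX Y NY K \<and>
     (\<forall>u :: nat \<Rightarrow> 'a \<Rightarrow> complex. (\<forall>n. u n \<in> X \<and> NX (u n) \<le> 1) \<longrightarrow>
        (\<exists>r :: nat \<Rightarrow> nat. \<exists>g\<in>Y. strict_mono r \<and>
           (\<lambda>n. NY (\<lambda>y. K (u (r n)) y - g y)) \<longlonglongrightarrow> 0))"

definition op_norm ::
  "('a \<Rightarrow> complex) set \<Rightarrow> (('a \<Rightarrow> complex) \<Rightarrow> real) \<Rightarrow> (('b \<Rightarrow> complex) \<Rightarrow> real) \<Rightarrow>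
   (('a \<Rightarrow> complex) \<Rightarrow> 'b \<Rightarrow> complex) \<Rightarrow> real" where
  "op_norm X NX NY A = (SUP f\<in>{f \<in> X. NX f \<le> 1}. NY (A f))"

text \<open>Only meaningful for a bounded \<open>A\<close>: then every \<open>A - K\<close> is bounded, so that the real-valued
  suprema and the infimum are genuine.\<close>

definition essential_norm ::
  "('a \<Rightarrow> complex) set \<Rightarrow> (('a \<Rightarrow> complex) \<Rightarrow> real) \<Rightarrow>
   ('b \<Rightarrow> complex) set \<Rightarrow> (('b \<Rightarrow> complex) \<Rightarrow> real) \<Rightarrow>
   (('a \<Rightarrow> complex) \<Rightarrow> 'b \<Rightarrow> complex) \<Rightarrow> real" where
  "essential_norm X NX Y NY A =
     (INF K\<in>{K. compact_linear_op X NX Y NY K}. op_norm X NX NY (\<lambda>f y. A f y - K f y))"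

end

theory Submission
  imports Defs "HOL-Probability.Probability_Measure" "HOL-Library.Function_Algebras"
begin

text \<open>Write \<open>B f = (f - f(0)) / z\<close> for the Toeplitz operator, \<open>S f = z f\<close>, and let \<open>K\<close> be compact.
  Since \<open>B S = I\<close>, we have \<open>B - K = B (I - S K)\<close> with \<open>S K\<close> compact, and \<open>B 1 = 0\<close>. By the Fredholm
  alternative either \<open>I - S K\<close> is not bounded below or it maps some \<open>f \<noteq> 0\<close> to \<open>1\<close>; in both cases
  \<open>B - K\<close> has an approximate kernel vector \<open>f\<close> of norm one. Put \<open>u = f \<psi>(z\<^sup>n)\<close> with
  \<open>\<psi>(z) = z + \<epsilon> z\<^sup>2\<close>. For large \<open>n\<close> the function \<open>K u\<close> is small, so \<open>B - K\<close> maps \<open>t f + u\<close>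
  to nearly \<open>B u\<close>, whose norm is that of \<open>u\<close>. For \<open>p \<noteq> 2\<close> the constants \<open>\<epsilon>\<close> and \<open>t\<close> can be chosen
  such that \<open>t f + u\<close> is shorter than \<open>u\<close> by a factor \<open>\<kappa> < 1\<close> that depends only on \<open>p\<close>, whence
  the norm of \<open>B - K\<close> is at least \<open>1 / \<kappa>\<close>.\<close>

section \<open>Integration on the circle\<close>

text \<open>The essential norm is an infimum over all \<open>K\<close>, so a gain that depends on
  \<open>K\<close> is worthless, yet nothing is known about the vector \<open>f\<close>. The fast
  oscillation of \<open>\<psi>(z\<^sup>n)\<close> separates the two: for large \<open>n\<close> the
  \<open>p\<close>-th power of the norm of \<open>t f + u\<close> approaches that of
  \<open>f\<close> times the mean of \<open>|t + \<psi>|\<^sup>p\<close> over the circle, and only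
  this mean matters. With \<open>\<psi>(z) = z\<close> alone there is no gain, since the
  \<open>p\<close>-th power of \<open>|1 + t z|\<close> is subharmonic and has mean at least 1. The
  second harmonic breaks this: the derivative of the mean in \<open>t\<close> at 0 is
  \<open>p (p - 2) \<epsilon> / 2\<close> to first order in \<open>\<epsilon>\<close>. It vanishes
  for \<open>p = 2\<close>, where constants are orthogonal to \<open>\<psi>\<close>; otherwise a
  small \<open>t\<close> of the right sign shortens the vector, while \<open>t f\<close> hardly
  changes the image because \<open>f\<close> is nearly in the kernel.\<close>

lemma space_circle_measure [simp]: "space circle_measure = sphere 0 1"
  by (simp add: circle_measure_def space_restrict_space)

lemma sets_circle_measure: "sets circle_measure = sets (restrict_space borel (sphere 0 1))"
  by (simp add: circle_measure_def)

lemma borel_measurable_circle: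
  "f \<in> borel_measurable borel \<Longrightarrow> f \<in> borel_measurable circle_measure"
  using measurable_restrict_space1 measurable_cong_sets[OF sets_circle_measure refl] by blast

lemma cis_measurable_sphere:
  "cis \<in> measurable lborel (restrict_space borel (sphere 0 1))"
  by (rule measurable_restrict_space2) (auto intro!: borel_measurable_continuous_onI continuous_intros)

lemma cis_measurable_circle:
  "cis \<in> measurable (uniform_measure lborel {-pi..pi}) (restrict_space borel (sphere 0 1))"
  using cis_measurable_sphere measurable_cong_sets[of "uniform_measure lborel {-pi..pi}" lborel]
  by auto

lemma uniform_measure_eq_density:
  "uniform_measure lborel {-pi..pi} = density lborel (\<lambda>x. ennreal (indicator {-pi..pi} x / (2 * pi)))"
proof -
  have "indicator {-pi..pi} x / ennreal (2 * pi) = ennreal (indicator {-pi..pi} x / (2 * pi))" for x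
    by (simp add: divide_ennreal[symmetric] ennreal_indicator)
  then show ?thesis
    unfolding uniform_measure_def by simp
qed

lemma prob_space_circle_measure: "prob_space circle_measure"
  unfolding circle_measure_def
  by (rule prob_space.prob_space_distr)
    (auto intro!: prob_space_uniform_measure cis_measurable_circle)

interpretation circle: prob_space circle_measure
  by (rule prob_space_circle_measure)

lemma circle_integral_eq:
  fixes f :: "complex \<Rightarrow> 'b :: {banach, second_countable_topology}"
  assumes "f \<in> borel_measurable circle_measure"
  shows "integral\<^sup>L circle_measure f = (1 / (2 * pi)) *\<^sub>R (LINT \<theta>:{-pi..pi}|lborel. f (cis \<theta>))"
proof -
  have f: "f \<in> borel_measurable (restrict_space borel (sphere 0 1))"
    using assms measurable_cong_sets[OF sets_circle_measure refl] by blast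
  have m: "(\<lambda>\<theta>. f (cis \<theta>)) \<in> borel_measurable lborel"
    using measurable_compose[OF cis_measurable_sphere f] .
  have "integral\<^sup>L circle_measure f = (LINT x|uniform_measure lborel {-pi..pi}. f (cis x))"
    unfolding circle_measure_def by (rule integral_distr[OF cis_measurable_circle f])
  also have "\<dots> = (LINT x|lborel. (indicator {-pi..pi} x / (2 * pi)) *\<^sub>R f (cis x))"
    unfolding uniform_measure_eq_density
    by (rule integral_density) (use m in auto)
  also have "\<dots> = (LINT x|lborel. (1 / (2*pi)) *\<^sub>R (indicator {-pi..pi} x *\<^sub>R f (cis x)))"
    by (rule Bochner_Integration.integral_cong) (auto simp: indicator_def)
  also have "\<dots> = (1 / (2*pi)) *\<^sub>R (LINT x|lborel. indicator {-pi..pi} x *\<^sub>R f (cis x))"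
    by (rule integral_scaleR_right)
  finally show ?thesis by (simp add: set_lebesgue_integral_def)
qed

lemma borel_measurable_power_int [measurable (raw)]:
  "(\<lambda>z::complex. z powi k) \<in> borel_measurable borel"
  unfolding power_int_def by (cases "k \<ge> 0") auto

lemma fourier_eq:
  assumes "f \<in> borel_measurable circle_measure"
  shows "fourier f k = (LINT z|circle_measure. f z * z powi (-k))"
proof -
  have "cis \<theta> powi (-k) = exp (- \<i> * of_int k * of_real \<theta>)" for \<theta>
    unfolding cis_power_int by (simp add: cis_conv_exp algebra_simps)
  moreover have "(\<lambda>z. f z * z powi (-k)) \<in> borel_measurable circle_measure"
    by (rule borel_measurable_times[OF assms borel_measurable_circle[OF borel_measurable_power_int]])
  ultimately show ?thesis
    by (simp add: circle_integral_eq fourier_def scaleR_conv_of_real)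
qed

lemma circle_integral_powi:
  "(LINT z|circle_measure. z powi k) = (if k = 0 then 1 else 0)"
proof (cases "k = 0")
  case True
  then show ?thesis using circle.prob_space by simp
next
  case False
  have k: "(LINT \<theta>:{-pi..pi}|lborel. cis (of_int k * \<theta>)) = 0"
  proof -
    have c: "continuous_on {-pi..pi} (\<lambda>\<theta>. cis (of_int k * \<theta>))"
      by (intro continuous_intros)
    have "set_integrable lborel {-pi..pi} (\<lambda>\<theta>. cis (of_int k * \<theta>))"
      unfolding set_integrable_def by (rule borel_integrable_compact) (use c in auto)
    then have "(LINT \<theta>:{-pi..pi}|lborel. cis (of_int k * \<theta>)) = integral {-pi..pi} (\<lambda>\<theta>. cis (of_int k * \<theta>))"
      by (rule set_borel_integral_eq_integral)
    also have "((\<lambda>\<theta>. cis (of_int k * \<theta>)) has_integral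
        (cis (of_int k * pi) / (\<i> * of_int k) - cis (of_int k * (-pi)) / (\<i> * of_int k))) {-pi..pi}"
    proof (rule fundamental_theorem_of_calculus)
      fix x :: real assume "x \<in> {-pi..pi}"
      have e: "cis (of_int k * y) = exp (\<i> * of_int k * of_real y)" for y
        by (simp add: cis_conv_exp algebra_simps)
      have "((\<lambda>z. exp (\<i> * of_int k * z) / (\<i> * of_int k)) has_field_derivative exp (\<i> * of_int k * of_real x)) (at (of_real x))"
        using False by (auto intro!: derivative_eq_intros)
      then have "((\<lambda>t. exp (\<i> * of_int k * of_real t) / (\<i> * of_int k)) has_vector_derivative exp (\<i> * of_int k * of_real x)) (at x within {-pi..pi})"
        by (rule has_vector_derivative_real_field)
      then show "((\<lambda>a. cis (real_of_int k * a) / (\<i> * of_int k)) has_vector_derivative cis (real_of_int k * x)) (at x within {- pi..pi})"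
        unfolding e .
    qed simp
    then have "integral {-pi..pi} (\<lambda>\<theta>. cis (of_int k * \<theta>)) =
      (cis (of_int k * pi) / (\<i> * of_int k) - cis (of_int k * (-pi)) / (\<i> * of_int k))"
      by (rule integral_unique)
    \<comment> \<open>The two end values are complex conjugates; they agree because the sine
      vanishes at integer multiples of \<open>pi\<close>.\<close>
    also have "cis (of_int k * pi) = cis (of_int k * (-pi))"
      using sin_times_pi_eq_0[of "of_int k"] by (simp add: complex_eq_iff)
    finally show ?thesis by simp
  qed
  have "(LINT z|circle_measure. z powi k) = (1/(2*pi)) *\<^sub>R (LINT \<theta>:{-pi..pi}|lborel. cis \<theta> powi k)"
    by (rule circle_integral_eq[OF borel_measurable_circle[OF borel_measurable_power_int]])
  then show ?thesis using k False by (simp add: cis_power_int)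
qed

lemma AE_circle: "(\<And>z. norm z = 1 \<Longrightarrow> P z) \<Longrightarrow> AE z in circle_measure. P z"
  by (rule AE_I2) simp

lemma Linf_norm_e_minus_one: "Linf_norm e_minus_one = 1"
proof -
  have "Linf_norm e_minus_one = esssup circle_measure (\<lambda>z. 1)"
    unfolding Linf_norm_def
    by (rule esssup_AE_cong)
       (auto simp: e_minus_one_def norm_power_int one_ereal_def norm_inverse intro!: AE_circle borel_measurable_circle)
  also have "\<dots> = 1"
    by (rule esssup_const) (simp only: circle.emeasure_space_1, simp)
  finally show ?thesis .
qed

section \<open>Minkowski inequality and \<open>L\<^sup>p\<close> of the circle\<close>

lemma powr_convex_combination:
  fixes p t u v :: real
  assumes "p \<ge> 1" "0 \<le> t" "t \<le> 1" "0 \<le> u" "0 \<le> v"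
  shows "(t * u + (1 - t) * v) powr p \<le> t * u powr p + (1 - t) * v powr p"
proof -
  \<comment> \<open>Convexity is applied at positive arguments only. If \<open>u\<close> or
    \<open>v\<close> is 0, what remains is this inequality for a weight \<open>c\<close> in
    [0, 1].\<close>
  have small: "c powr p \<le> c" if "0 \<le> c" "c \<le> 1" for c :: real
    using powr_mono'[of 1 p c] that assms by simp
  consider "u = 0" | "v = 0" | "u > 0" "v > 0" using assms by fastforce
  then show ?thesis
  proof cases
    case 1
    then show ?thesis using small[of "1 - t"] assms by (auto simp: powr_mult intro: mult_right_mono)
  next
    case 2
    then show ?thesis using small[of t] assms by (auto simp: powr_mult intro: mult_right_mono)
  next
    case 3
    then show ?thesis
      using convex_onD[OF powr_convex[OF assms(1)], of "1 - t" u v] assms by simp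
  qed
qed

text \<open>Convexity of the \<open>p\<close>-th power with weights \<open>a / (a + b)\<close> and
  \<open>b / (a + b)\<close>, applied to the normalised \<open>norm x / a\<close> and
  \<open>norm y / b\<close>. After integration, any \<open>a\<close> and \<open>b\<close> that bound
  the two \<open>L\<^sup>p\<close> norms make the last factor at most \<open>a + b\<close>, which
  gives Minkowski's inequality.\<close>

lemma norm_add_powr_le:
  fixes x y :: "'b::real_normed_vector" and a b p :: real
  assumes "p \<ge> 1" "a > 0" "b > 0"
  shows "norm (x + y) powr p \<le> (a + b) powr p / (a + b) * (a * (norm x powr p / a powr p) + b * (norm y powr p / b powr p))"
proof -
  define t where "t = a / (a + b)"
  have t: "0 \<le> t" "t \<le> 1" "1 - t = b / (a + b)" using assms by (auto simp: t_def field_simps)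
  have "norm (x + y) \<le> (a + b) * (t * (norm x / a) + (1 - t) * (norm y / b))"
  proof -
    have "a + b \<noteq> 0" using assms by simp
    then have "(a + b) * (t * (norm x / a) + (1 - t) * (norm y / b)) = norm x + norm y"
      unfolding t(3) unfolding t_def using assms(2,3) by (simp add: distrib_left)
    then show ?thesis by (simp add: norm_triangle_ineq)
  qed
  then have "norm (x + y) powr p \<le> ((a + b) * (t * (norm x / a) + (1 - t) * (norm y / b))) powr p"
    using assms by (intro powr_mono2) auto
  also have "\<dots> = (a + b) powr p * (t * (norm x / a) + (1 - t) * (norm y / b)) powr p"
    by (rule powr_mult)
  also have "\<dots> \<le> (a + b) powr p * (t * (norm x / a) powr p + (1 - t) * (norm y / b) powr p)"
    using assms t by (intro mult_left_mono powr_convex_combination) auto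
  also have "\<dots> = (a + b) powr p / (a + b) * (a * (norm x powr p / a powr p) + b * (norm y powr p / b powr p))"
  proof -
    have gen: "P * (a / (a + b) * u + b / (a + b) * v) = P / (a + b) * (a * u + b * v)" for P u v
      by (simp add: divide_inverse algebra_simps)
    show ?thesis unfolding t(3) unfolding t_def powr_divide by (rule gen)
  qed
  finally show ?thesis .
qed

lemma integrable_norm_add_powr:
  fixes f g :: "'a \<Rightarrow> 'b::{real_normed_vector, second_countable_topology}"
  assumes p: "p \<ge> 1" and [measurable]: "f \<in> borel_measurable M" "g \<in> borel_measurable M"
    and "integrable M (\<lambda>x. norm (f x) powr p)" "integrable M (\<lambda>x. norm (g x) powr p)"
  shows "integrable M (\<lambda>x. norm (f x + g x) powr p)"
proof (rule Bochner_Integration.integrable_bound)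
  show "integrable M (\<lambda>x. 2 powr p / 2 * (norm (f x) powr p + norm (g x) powr p))"
    using assms by auto
  show "AE x in M. norm (norm (f x + g x) powr p) \<le> norm (2 powr p / 2 * (norm (f x) powr p + norm (g x) powr p))"
    using norm_add_powr_le[OF p, of 1 1] by (intro AE_I2) (simp add: order.trans[OF _ abs_ge_self])
qed measurable

theorem Minkowski_inequality:
  fixes f g :: "'a \<Rightarrow> 'b::{real_normed_vector, second_countable_topology}"
  assumes p: "p \<ge> 1" and m: "f \<in> borel_measurable M" "g \<in> borel_measurable M"
    and i: "integrable M (\<lambda>x. norm (f x) powr p)" "integrable M (\<lambda>x. norm (g x) powr p)"
  shows "(LINT x|M. norm (f x + g x) powr p) powr (1 / p)
    \<le> (LINT x|M. norm (f x) powr p) powr (1 / p) + (LINT x|M. norm (g x) powr p) powr (1 / p)"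
proof (rule field_le_epsilon)
  fix e :: real assume e: "e > 0"
  \<comment> \<open>Enlarging both norms by \<open>e / 2\<close> makes them positive, as the normalisation by \<open>a\<close> and \<open>b\<close> requires.\<close>
  define A B where "A = (LINT x|M. norm (f x) powr p)" and "B = (LINT x|M. norm (g x) powr p)"
  define a b where "a = A powr (1 / p) + e / 2" and "b = B powr (1 / p) + e / 2"
  have ab: "a > 0" "b > 0" using e by (auto simp: a_def b_def add_nonneg_pos)
  have A: "A \<le> a powr p"
  proof -
    have "A = (A powr (1 / p)) powr p" using p by (simp add: powr_powr A_def)
    also have "\<dots> \<le> a powr p" using p e by (intro powr_mono2) (auto simp: a_def)
    finally show ?thesis .
  qed
  have B: "B \<le> b powr p"
  proof -
    have "B = (B powr (1 / p)) powr p" using p by (simp add: powr_powr B_def)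
    also have "\<dots> \<le> b powr p" using p e by (intro powr_mono2) (auto simp: b_def)
    finally show ?thesis .
  qed
  have "(LINT x|M. norm (f x + g x) powr p) \<le>
      (LINT x|M. (a + b) powr p / (a + b) * (a * (norm (f x) powr p / a powr p) + b * (norm (g x) powr p / b powr p)))"
    using i by (intro integral_mono integrable_norm_add_powr p m norm_add_powr_le ab) auto
  also have "\<dots> = (a + b) powr p / (a + b) * (a * (A / a powr p) + b * (B / b powr p))"
    using i by (simp add: A_def B_def)
  also have "\<dots> \<le> (a + b) powr p / (a + b) * (a * 1 + b * 1)"
    using A B ab by (intro mult_left_mono add_mono) auto
  also have "\<dots> = (a + b) powr p" using ab by simp
  finally have "(LINT x|M. norm (f x + g x) powr p) powr (1 / p) \<le> ((a + b) powr p) powr (1 / p)"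
    using p by (intro powr_mono2) auto
  also have "\<dots> = a + b" using p ab by (simp add: powr_powr)
  finally show "(LINT x|M. norm (f x + g x) powr p) powr (1 / p) \<le> A powr (1 / p) + B powr (1 / p) + e"
    by (simp add: a_def b_def)
qed

section \<open>The space \<open>Lp p\<close> and its seminorm\<close>

lemma Lp_measurable: "f \<in> Lp p \<Longrightarrow> f \<in> borel_measurable circle_measure"
  and Lp_integrable_powr: "f \<in> Lp p \<Longrightarrow> integrable circle_measure (\<lambda>z. norm (f z) powr p)"
  by (auto simp: Lp_def)

lemma Lp_norm_nonneg: "Lp_norm p f \<ge> 0"
  by (simp add: Lp_norm_def)

lemma Lp_norm_powr: "p > 0 \<Longrightarrow> Lp_norm p f powr p = (LINT z|circle_measure. norm (f z) powr p)"
  by (simp add: Lp_norm_def powr_powr)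

lemma Lp_add: "p \<ge> 1 \<Longrightarrow> f \<in> Lp p \<Longrightarrow> g \<in> Lp p \<Longrightarrow> (\<lambda>z. f z + g z) \<in> Lp p"
  by (auto simp: Lp_def intro: integrable_norm_add_powr)

lemma Lp_norm_triangle:
  "p \<ge> 1 \<Longrightarrow> f \<in> Lp p \<Longrightarrow> g \<in> Lp p \<Longrightarrow> Lp_norm p (\<lambda>z. f z + g z) \<le> Lp_norm p f + Lp_norm p g"
  unfolding Lp_norm_def Lp_def by (auto intro: Minkowski_inequality)

lemma Lp_norm_cmult: "p > 0 \<Longrightarrow> Lp_norm p (\<lambda>z. c * f z) = norm c * Lp_norm p f"
  by (simp add: Lp_norm_def norm_mult powr_mult powr_powr)

lemma Lp_mult_bounded:
  assumes "p > 0" "f \<in> Lp p" "g \<in> borel_measurable circle_measure" "\<And>z. norm z = 1 \<Longrightarrow> norm (g z) \<le> B"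
  shows "(\<lambda>z. g z * f z) \<in> Lp p"
proof -
  note [measurable] = Lp_measurable[OF assms(2)] assms(3)
  have "integrable circle_measure (\<lambda>z. norm (g z * f z) powr p)"
  proof (rule Bochner_Integration.integrable_bound)
    show "integrable circle_measure (\<lambda>z. B powr p * norm (f z) powr p)"
      using Lp_integrable_powr[OF assms(2)] by simp
    have "norm (norm (g z * f z) powr p) \<le> norm (B powr p * norm (f z) powr p)" if "norm z = 1" for z
      using assms(1) assms(4)[OF that]
      by (simp add: norm_mult powr_mult powr_mono2 mult_right_mono order_trans[OF norm_ge_zero])
    then show "AE z in circle_measure. norm (norm (g z * f z) powr p) \<le> norm (B powr p * norm (f z) powr p)"
      by (rule AE_circle)
  qed measurable
  then show ?thesis by (simp add: Lp_def)
qed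

lemma Lp_cmult: "p > 0 \<Longrightarrow> f \<in> Lp p \<Longrightarrow> (\<lambda>z. c * f z) \<in> Lp p"
  by (rule Lp_mult_bounded[of p f "\<lambda>_. c" "norm c"]) auto

lemma Lp_const: "(\<lambda>z. c) \<in> Lp p"
  by (simp add: Lp_def)

lemma Lp_norm_const: "p > 0 \<Longrightarrow> Lp_norm p (\<lambda>z. c) = norm c"
  using circle.prob_space by (simp add: Lp_norm_def powr_powr)

lemma Lp_norm_cong:
  assumes "\<And>z. norm z = 1 \<Longrightarrow> norm (f z) = norm (g z)"
  shows "Lp_norm p f = Lp_norm p g"
proof -
  have "(LINT z|circle_measure. norm (f z) powr p) = (LINT z|circle_measure. norm (g z) powr p)"
    using assms by (intro Bochner_Integration.integral_cong) auto
  then show ?thesis by (simp add: Lp_norm_def)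
qed

lemma Lp_norm_eq_0_iff:
  assumes "p > 0" "f \<in> Lp p"
  shows "Lp_norm p f = 0 \<longleftrightarrow> (AE z in circle_measure. f z = 0)"
proof -
  have "Lp_norm p f = 0 \<longleftrightarrow> (LINT z|circle_measure. norm (f z) powr p) = 0"
    by (simp add: Lp_norm_def)
  also have "\<dots> \<longleftrightarrow> (AE z in circle_measure. norm (f z) powr p = 0)"
    using Lp_integrable_powr[OF assms(2)] by (intro integral_nonneg_eq_0_iff_AE) auto
  finally show ?thesis using assms(1) by simp
qed

text \<open>Both claims come from \<open>x \<le> 1 + x powr p\<close>. For the second it is used at
  \<open>norm (f z) / Lp_norm p f\<close>, which costs the constant 2 where Jensen's inequality
  would give 1; later only the boundedness of the mean matters.\<close>

lemma Lp_integrable: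
  assumes "p \<ge> 1" "f \<in> Lp p"
  shows "integrable circle_measure f"
    and "(LINT z|circle_measure. norm (f z)) \<le> 2 * Lp_norm p f"
proof -
  note [measurable] = Lp_measurable[OF assms(2)]
  have le: "x \<le> 1 + x powr p" if "x \<ge> 0" for x :: real
  proof (cases "x \<le> 1")
    case True
    then show ?thesis using powr_ge_zero[of x p] by linarith
  next
    case False
    then show ?thesis using powr_mono[of 1 p x] assms by simp
  qed
  show i: "integrable circle_measure f"
  proof (rule Bochner_Integration.integrable_bound)
    show "integrable circle_measure (\<lambda>z. 1 + norm (f z) powr p)"
      using Lp_integrable_powr[OF assms(2)] by simp
    show "AE z in circle_measure. norm (f z) \<le> norm (1 + norm (f z) powr p)"
      using le by (intro AE_I2) (simp add: order.trans[OF _ abs_ge_self])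
  qed measurable
  let ?N = "Lp_norm p f"
  show "(LINT z|circle_measure. norm (f z)) \<le> 2 * ?N"
  proof (cases "?N = 0")
    case True
    then have "AE z in circle_measure. f z = 0" using Lp_norm_eq_0_iff assms by simp
    then have "(LINT z|circle_measure. norm (f z)) = 0" by (intro integral_eq_zero_AE) auto
    then show ?thesis using True by simp
  next
    case False
    then have N: "?N > 0" using Lp_norm_nonneg[of p f] by simp
    have "norm (f z) \<le> ?N * (1 + norm (f z) powr p / ?N powr p)" for z
      using le[of "norm (f z) / ?N"] N by (simp add: powr_divide field_simps)
    then have "(LINT z|circle_measure. norm (f z)) \<le> (LINT z|circle_measure. ?N * (1 + norm (f z) powr p / ?N powr p))"
      using i Lp_integrable_powr[OF assms(2)] by (intro integral_mono) auto
    also have "\<dots> = ?N * (1 + ?N powr p / ?N powr p)"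
      using Lp_integrable_powr[OF assms(2)] Lp_norm_powr[of p f] assms circle.prob_space by simp
    also have "\<dots> = 2 * ?N" using N by simp
    finally show ?thesis .
  qed
qed

section \<open>Rules for Fourier coefficients\<close>

lemma integrable_powi_mult:
  assumes "integrable circle_measure f"
  shows "integrable circle_measure (\<lambda>z. f z * z powi k)"
proof (rule Bochner_Integration.integrable_bound[OF assms])
  show "(\<lambda>z. f z * z powi k) \<in> borel_measurable circle_measure"
    using assms by (intro borel_measurable_times borel_measurable_circle[OF borel_measurable_power_int]) auto
  show "AE z in circle_measure. norm (f z * z powi k) \<le> norm (f z)"
    by (rule AE_circle) (simp add: norm_mult norm_power_int)
qed

lemma fourier_add:
  assumes "integrable circle_measure f" "integrable circle_measure g"
  shows "fourier (\<lambda>z. f z + g z) k = fourier f k + fourier g k"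
proof -
  have [measurable]: "f \<in> borel_measurable circle_measure" "g \<in> borel_measurable circle_measure" using assms by auto
  show ?thesis
    using integrable_powi_mult[OF assms(1), of "-k"] integrable_powi_mult[OF assms(2), of "-k"]
    by (subst (1 2 3) fourier_eq) (simp_all only: distrib_right Bochner_Integration.integral_add, measurable)
qed

lemma fourier_cmult:
  assumes "f \<in> borel_measurable circle_measure"
  shows "fourier (\<lambda>z. c * f z) k = c * fourier f k"
  using assms by (simp add: fourier_eq mult.assoc)

lemma fourier_mult_powi:
  assumes "f \<in> borel_measurable circle_measure"
  shows "fourier (\<lambda>z. z powi m * f z) k = fourier f (k - m)"
proof -
  have "(\<lambda>z. z powi m * f z) \<in> borel_measurable circle_measure"
    by (rule borel_measurable_times[OF borel_measurable_circle[OF borel_measurable_power_int] assms])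
  then have "fourier (\<lambda>z. z powi m * f z) k = (LINT z|circle_measure. z powi m * f z * z powi (-k))"
    by (rule fourier_eq)
  also have "\<dots> = (LINT z|circle_measure. f z * z powi (-(k - m)))"
  proof (rule Bochner_Integration.integral_cong[OF refl])
    fix z assume "z \<in> space circle_measure"
    then have "z \<noteq> 0" by auto
    then show "z powi m * f z * z powi (-k) = f z * z powi (-(k - m))"
      by (simp add: power_int_diff power_int_minus field_simps)
  qed
  finally show ?thesis using fourier_eq[OF assms] by simp
qed

lemma fourier_const: "fourier (\<lambda>z. c) k = (if k = 0 then c else 0)"
  using circle_integral_powi[of "-k"] by (simp add: fourier_eq)

lemma norm_fourier_le:
  assumes "f \<in> borel_measurable circle_measure"
  shows "norm (fourier f k) \<le> (LINT z|circle_measure. norm (f z))"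
proof -
  have "norm (fourier f k) \<le> (LINT z|circle_measure. norm (f z * z powi (-k)))"
    unfolding fourier_eq[OF assms] by (rule integral_norm_bound)
  also have "\<dots> = (LINT z|circle_measure. norm (f z))"
    by (rule Bochner_Integration.integral_cong) (auto simp: norm_mult norm_power_int)
  finally show ?thesis .
qed

section \<open>Uniqueness of Fourier coefficients\<close>

lemma circle_integrable_mult_bounded:
  fixes f g :: "complex \<Rightarrow> 'a :: {banach, second_countable_topology, real_normed_field}"
  assumes "integrable circle_measure f" "g \<in> borel_measurable circle_measure"
    "\<And>z. norm z = 1 \<Longrightarrow> norm (g z) \<le> B"
  shows "integrable circle_measure (\<lambda>z. f z * g z)"
proof (rule Bochner_Integration.integrable_bound)
  show "integrable circle_measure (\<lambda>z. B * norm (f z))" using assms by simp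
  show "(\<lambda>z. f z * g z) \<in> borel_measurable circle_measure"
    using assms by (intro borel_measurable_times) auto
  show "AE z in circle_measure. norm (f z * g z) \<le> norm (B * norm (f z))"
  proof (rule AE_circle)
    fix z :: complex assume "norm z = 1"
    then have "norm (g z) * norm (f z) \<le> B * norm (f z)" by (intro mult_right_mono assms) auto
    then show "norm (f z * g z) \<le> norm (B * norm (f z))"
      by (simp add: norm_mult mult.commute order.trans[OF _ abs_ge_self])
  qed
qed

text \<open>On the circle a real linear form is a combination of \<open>z\<close> and its inverse,
  and multiplication by a power of \<open>z\<close> only shifts the coefficients of
  \<open>h\<close>. The function \<open>h\<close> stays arbitrary in the induction so that a product
  of polynomials is treated as two successive multiplications.\<close>

lemma fourier_zero_mult_polynomial:
  fixes g :: "complex \<Rightarrow> real"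
  assumes "real_polynomial_function g" "integrable circle_measure h" "\<And>k. fourier h k = 0"
  shows "integrable circle_measure (\<lambda>z. h z * of_real (g z)) \<and> (\<forall>k. fourier (\<lambda>z. h z * of_real (g z)) k = 0)"
  using assms
proof (induction g arbitrary: h rule: real_polynomial_function.induct)
  case (linear g)
  interpret g: bounded_linear g by fact
  \<comment> \<open>Chosen so that \<open>g z\<close> is twice the real part of
    \<open>c * z\<close>; on the circle the conjugate of \<open>z\<close> is its inverse.\<close>
  define c where "c = (of_real (g 1) - \<i> * of_real (g \<i>)) / 2"
  have gz: "of_real (g z) = c * z powi 1 + cnj c * z powi (-1)" if "norm z = 1" for z
  proof -
    have "z = Re z *\<^sub>R 1 + Im z *\<^sub>R \<i>" by (simp add: complex_eq_iff)
    then have "g z = Re z * g 1 + Im z * g \<i>" by (metis g.add g.scaleR real_scaleR_def)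
    moreover have "inverse z = cnj z"
      using that by (simp add: inverse_complex_def complex_eq_iff cmod_def)
    ultimately show ?thesis
      unfolding power_int_minus power_int_1_right by (simp add: c_def complex_eq_iff algebra_simps diff_divide_distrib)
  qed
  have m: "h \<in> borel_measurable circle_measure" using linear by auto
  have i: "integrable circle_measure (\<lambda>z. a * (z powi k * h z))" for a k
    using integrable_powi_mult[OF linear(2), of k] by (simp add: mult.commute)
  have f: "fourier (\<lambda>z. a * (z powi k * h z)) j = 0" for a k j
  proof -
    have "(\<lambda>z. z powi k * h z) \<in> borel_measurable circle_measure" using i[of 1 k] by auto
    then show ?thesis by (simp add: fourier_cmult fourier_mult_powi m linear(3))
  qed
  let ?s = "\<lambda>z. c * (z powi 1 * h z) + cnj c * (z powi (-1) * h z)"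
  have s: "integrable circle_measure ?s" by (intro Bochner_Integration.integrable_add i)
  have eq: "h z * of_real (g z) = ?s z" if "norm z = 1" for z
    unfolding gz[OF that] by (simp add: algebra_simps)
  have int: "integrable circle_measure (\<lambda>z. h z * of_real (g z))"
    using s by (rule Bochner_Integration.integrable_cong[THEN iffD1, rotated -1]) (auto simp: eq)
  moreover have "fourier (\<lambda>z. h z * of_real (g z)) k = fourier ?s k" for k
    unfolding fourier_def by (simp only: eq norm_cis)
  moreover have "fourier ?s k = 0" for k
    by (subst fourier_add[OF i i]) (simp only: f add_0_left)
  ultimately show ?case by (simp only: simp_thms)
next
  case (const c)
  then show ?case using fourier_cmult[of h "of_real c"] by (auto simp: mult.commute)
next
  case (add f g)
  from add.IH(1)[OF add.prems] add.IH(2)[OF add.prems] show ?case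
    using fourier_add[of "\<lambda>z. h z * of_real (f z)" "\<lambda>z. h z * of_real (g z)"] by (simp add: distrib_left)
next
  case (mult f g)
  from mult.IH(1)[OF mult.prems] have "integrable circle_measure (\<lambda>z. h z * of_real (f z))"
    "\<And>k. fourier (\<lambda>z. h z * of_real (f z)) k = 0" by auto
  from mult.IH(2)[OF this] show ?case by (simp add: mult.assoc)
qed

text \<open>For a polynomial \<open>q\<close> the integral of \<open>h q\<close> is a zeroth Fourier
  coefficient and vanishes. Stone-Weierstrass approximates \<open>g\<close> uniformly on the circle,
  and the error is controlled by the integral of \<open>norm (h z)\<close>.\<close>

lemma integral_mult_continuous_eq_0:
  fixes g :: "complex \<Rightarrow> real"
  assumes h: "integrable circle_measure h" "\<And>k. fourier h k = 0" and g: "continuous_on UNIV g"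
  shows "(LINT z|circle_measure. h z * of_real (g z)) = 0"
proof -
  define I where "I = (LINT z|circle_measure. norm (h z))"
  have I: "I \<ge> 0" by (simp add: I_def)
  have gm: "(\<lambda>z. complex_of_real (g z)) \<in> borel_measurable circle_measure"
    using g by (intro borel_measurable_circle borel_measurable_continuous_onI continuous_intros)
  have "compact (g ` sphere 0 1)"
    using g by (intro compact_continuous_image) (auto intro: continuous_on_subset)
  then have "bounded (g ` sphere 0 1)" by (rule compact_imp_bounded)
  then obtain B where "\<forall>x\<in>g ` sphere 0 1. norm x \<le> B"
    unfolding bounded_iff by blast
  then have B: "norm (g z) \<le> B" if "norm z = 1" for z using that by simp
  have hg: "integrable circle_measure (\<lambda>z. h z * of_real (g z))"
    using B by (intro circle_integrable_mult_bounded[OF h(1) gm, of B]) simp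
  have "norm (LINT z|circle_measure. h z * of_real (g z)) \<le> 0 + e" if e: "e > 0" for e
  proof -
    have e': "e / (I + 1) > 0" using e I by simp
    obtain q where q: "real_polynomial_function q" and qg: "\<And>z. z \<in> sphere 0 1 \<Longrightarrow> \<bar>g z - q z\<bar> < e / (I + 1)"
      using Stone_Weierstrass_real_polynomial_function[OF _ _ e', of "sphere 0 1" g] g
      by (metis compact_sphere continuous_on_subset subset_UNIV)
    have hq: "integrable circle_measure (\<lambda>z. h z * of_real (q z))" "fourier (\<lambda>z. h z * of_real (q z)) 0 = 0"
      using fourier_zero_mult_polynomial[OF q h] by auto
    then have "(LINT z|circle_measure. h z * of_real (q z)) = 0"
      using fourier_eq[of "\<lambda>z. h z * of_real (q z)" 0] by auto
    then have "(LINT z|circle_measure. h z * of_real (g z)) = (LINT z|circle_measure. h z * of_real (g z) - h z * of_real (q z))"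
      using hg hq by simp
    also have "norm \<dots> \<le> (LINT z|circle_measure. norm (h z * of_real (g z) - h z * of_real (q z)))"
      by (rule integral_norm_bound)
    also have "\<dots> \<le> (LINT z|circle_measure. norm (h z) * (e / (I + 1)))"
    proof (rule integral_mono)
      show "integrable circle_measure (\<lambda>z. norm (h z * of_real (g z) - h z * of_real (q z)))"
        using hg hq by (intro integrable_norm Bochner_Integration.integrable_diff)
      show "integrable circle_measure (\<lambda>z. norm (h z) * (e / (I + 1)))" using h by simp
      fix z assume "z \<in> space circle_measure"
      then have "\<bar>g z - q z\<bar> \<le> e / (I + 1)" using qg[of z] by simp
      then have "norm (h z) * \<bar>g z - q z\<bar> \<le> norm (h z) * (e / (I + 1))" by (intro mult_left_mono) auto
      moreover have "norm (h z * of_real (g z) - h z * of_real (q z)) = norm (h z) * \<bar>g z - q z\<bar>"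
        by (simp add: norm_mult flip: right_diff_distrib of_real_diff)
      ultimately show "norm (h z * of_real (g z) - h z * of_real (q z)) \<le> norm (h z) * (e / (I + 1))" by simp
    qed
    also have "\<dots> = I * (e / (I + 1))" by (simp add: I_def)
    also have "\<dots> \<le> e" using I e by (simp add: field_simps)
    finally show ?thesis by simp
  qed
  then have "norm (LINT z|circle_measure. h z * of_real (g z)) \<le> 0" by (rule field_le_epsilon)
  then show ?thesis by simp
qed

lemma integral_indicator_closed_eq_0:
  assumes h: "integrable circle_measure h" "\<And>k. fourier h k = 0" and C: "closed C"
  shows "(LINT z|circle_measure. h z * indicator C z) = 0"
\<comment> \<open>The empty set is treated apart because \<open>infdist z {}\<close> is 0, which
  would make the functions \<open>g n\<close> below constantly 1.\<close>
proof (cases "C = {}")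
  case False
  have hm: "h \<in> borel_measurable circle_measure" using h by auto
  \<comment> \<open>Continuous ramps that are 1 on \<open>C\<close> and, for positive
    \<open>n\<close>, vanish at distance \<open>1 / n\<close> or more. They tend pointwise to the
    indicator because \<open>C\<close> is closed.\<close>
  define g where "g n z = max 0 (1 - real n * infdist z C)" for n z
  have "(\<lambda>n. LINT z|circle_measure. h z * of_real (g n z)) \<longlonglongrightarrow> (LINT z|circle_measure. h z * indicator C z)"
  proof (rule integral_dominated_convergence[where w = "\<lambda>z. norm (h z)"])
    have [measurable]: "C \<in> sets borel" using C by simp
    show "(\<lambda>z. h z * indicator C z) \<in> borel_measurable circle_measure"
      by (intro borel_measurable_times[OF hm] borel_measurable_circle) measurable
    have "continuous_on UNIV (\<lambda>z. complex_of_real (g n z))" for n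
      unfolding g_def by (intro continuous_intros)
    then show "(\<lambda>z. h z * of_real (g n z)) \<in> borel_measurable circle_measure" for n
      by (intro borel_measurable_times[OF hm] borel_measurable_circle borel_measurable_continuous_onI)
    show "integrable circle_measure (\<lambda>z. norm (h z))" using h by simp
    have "norm (h z) * \<bar>g n z\<bar> \<le> norm (h z) * 1" for n z
      by (rule mult_left_mono) (auto simp: g_def infdist_nonneg)
    then show "AE z in circle_measure. norm (h z * of_real (g n z)) \<le> norm (h z)" for n
      by (simp add: norm_mult)
    have "(\<lambda>n. complex_of_real (g n z)) \<longlonglongrightarrow> indicator C z" for z
    proof (cases "z \<in> C")
      case True
      then show ?thesis by (simp add: g_def)
    next
      case z: False
      then have "infdist z C > 0" using in_closed_iff_infdist_zero[OF C False, of z] infdist_nonneg[of z C] by simp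
      then obtain N :: nat where "1 < real N * infdist z C" using reals_Archimedean3 by blast
      then have "1 - real n * infdist z C \<le> 0" if "n \<ge> N" for n
        using that infdist_nonneg[of z C] mult_right_mono[of "real N" "real n" "infdist z C"] by simp
      then have "eventually (\<lambda>n. complex_of_real (g n z) = 0) sequentially"
        by (intro eventually_sequentiallyI[of N]) (simp add: g_def)
      then show ?thesis using z by (simp add: tendsto_eventually)
    qed
    then show "AE z in circle_measure. (\<lambda>n. h z * of_real (g n z)) \<longlonglongrightarrow> h z * indicator C z"
      by (intro AE_I2 tendsto_intros)
  qed
  moreover have "(LINT z|circle_measure. h z * of_real (g n z)) = 0" for n
    by (rule integral_mult_continuous_eq_0[OF h]) (auto simp: g_def intro!: continuous_intros)
  ultimately show ?thesis by (simp add: LIMSEQ_const_iff)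
qed simp

text \<open>A function whose integral over every measurable set is 0 vanishes almost everywhere.
  Closed sets are stable under intersection and generate the Borel sets, so it suffices to pass to
  complements, by \<open>total\<close>, and to countable disjoint unions, by dominated
  convergence.\<close>

theorem fourier_eq_0_imp_AE_eq_0:
  assumes h: "integrable circle_measure h" "\<And>k. fourier h k = 0"
  shows "AE z in circle_measure. h z = 0"
proof (rule circle.density_zero[OF h(1)])
  have i: "integrable circle_measure (\<lambda>z. h z * indicator A z)" if "A \<in> sets borel" for A
  proof (rule circle_integrable_mult_bounded[OF h(1), of _ 1])
    show "(indicator A :: complex \<Rightarrow> complex) \<in> borel_measurable circle_measure"
      by (rule borel_measurable_circle[OF borel_measurable_indicator[OF that]])
  qed (simp add: indicator_def)
  have total: "integral\<^sup>L circle_measure h = 0"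
    using integral_indicator_closed_eq_0[OF h, of UNIV] by simp
  have zero: "(LINT z|circle_measure. h z * indicator A z) = 0" if "A \<in> sets borel" for A
  proof -
    have "Int_stable (Collect closed :: complex set set)" by (auto simp: Int_stable_def)
    moreover have "Collect closed \<subseteq> Pow (UNIV :: complex set)" by simp
    moreover have "A \<in> sigma_sets UNIV (Collect closed)"
      using that unfolding borel_eq_closed by (simp add: sets_measure_of)
    ultimately show ?thesis
    proof (induction rule: sigma_sets_induct_disjoint)
      case empty
      show ?case by simp
    next
      case (basic A)
      then show ?case by (intro integral_indicator_closed_eq_0 h) simp
    next
      case (compl A)
      then have A: "A \<in> sets borel" unfolding borel_eq_closed by (simp add: sets_measure_of)
      have "h z * indicator (UNIV - A) z = h z - h z * indicator A z" for z by (auto simp: indicator_def)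
      then show ?case using compl total h i[OF A] by simp
    next
      case (union A)
      then have A: "A n \<in> sets borel" for n unfolding borel_eq_closed by (auto simp: sets_measure_of)
      have "(\<lambda>n. LINT z|circle_measure. h z * indicator (\<Union>i<n. A i) z) \<longlonglongrightarrow> (LINT z|circle_measure. h z * indicator (\<Union>i. A i) z)"
      proof (rule integral_dominated_convergence[where w = "\<lambda>z. norm (h z)"])
        show "(\<lambda>z. h z * indicator (\<Union>i. A i) z) \<in> borel_measurable circle_measure"
          using i[of "\<Union>i. A i"] A by auto
        show "(\<lambda>z. h z * indicator (\<Union>i<n. A i) z) \<in> borel_measurable circle_measure" for n
          using i[of "\<Union>i<n. A i"] A by auto
        show "integrable circle_measure (\<lambda>z. norm (h z))" using h by simp
        show "AE z in circle_measure. norm (h z * indicator (\<Union>i<n. A i) z) \<le> norm (h z)" for n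
          by (auto simp: indicator_def)
        have "(\<lambda>n. indicator (\<Union>i<n. A i) z :: complex) \<longlonglongrightarrow> indicator (\<Union>i. A i) z" for z
          by (rule LIMSEQ_indicator_UN)
        then show "AE z in circle_measure. (\<lambda>n. h z * indicator (\<Union>i<n. A i) z) \<longlonglongrightarrow> h z * indicator (\<Union>i. A i) z"
          by (intro AE_I2 tendsto_intros)
      qed
      moreover have "(LINT z|circle_measure. h z * indicator (\<Union>i<n. A i) z) = 0" for n
      proof (induction n)
        case (Suc n)
        have "A n \<inter> A i = {}" if "i < n" for i
          using union(1) that unfolding disjoint_family_on_def by simp
        then have "A n \<inter> (\<Union>i<n. A i) = {}" unfolding Int_UN_distrib by simp
        then have "indicator (\<Union>i<Suc n. A i) z = indicator (A n) z + (indicator (\<Union>i<n. A i) z :: complex)" for z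
          unfolding lessThan_Suc UN_insert
          by (cases "z \<in> A n"; cases "z \<in> (\<Union>i<n. A i)") (simp_all add: disjoint_iff)
        then have "h z * indicator (\<Union>i<Suc n. A i) z = h z * indicator (A n) z + h z * indicator (\<Union>i<n. A i) z" for z
          by (simp add: distrib_left)
        moreover have "integrable circle_measure (\<lambda>z. h z * indicator (\<Union>i<n. A i) z)"
          by (rule i) (use A in auto)
        ultimately show ?case using Suc union.IH i[OF A, of n] by simp
      qed simp
      ultimately show ?case by (simp add: LIMSEQ_const_iff)
    qed
  qed
  fix A assume "A \<in> sets circle_measure"
  then obtain B where B: "B \<in> sets borel" "A = sphere 0 1 \<inter> B"
    by (auto simp: sets_circle_measure sets_restrict_space)
  have "set_lebesgue_integral circle_measure A h = (LINT z|circle_measure. h z * indicator B z)"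
    unfolding set_lebesgue_integral_def
    by (rule Bochner_Integration.integral_cong) (auto simp: B indicator_def)
  then show "set_lebesgue_integral circle_measure A h = 0" using zero B by simp
qed

section \<open>Means of powers and the Riemann--Lebesgue lemma\<close>

text \<open>Split the weight at a level \<open>k\<close>: the excess \<open>max 0 (w z - k)\<close>
  has small integral for large \<open>k\<close>, also after multiplication by
  \<open>v n \<le> 1\<close>, and the rest contributes at most \<open>k\<close> times the integral
  of \<open>v n\<close>. The level is fixed before \<open>n\<close> grows.\<close>

lemma integral_mult_tendsto_0:
  fixes w :: "complex \<Rightarrow> real" and v :: "nat \<Rightarrow> complex \<Rightarrow> real"
  assumes w: "integrable circle_measure w" "\<And>z. w z \<ge> 0"
    and v: "\<And>n. v n \<in> borel_measurable circle_measure" "\<And>n z. norm z = 1 \<Longrightarrow> 0 \<le> v n z \<and> v n z \<le> 1"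
    and lim: "(\<lambda>n. LINT z|circle_measure. v n z) \<longlonglongrightarrow> 0"
  shows "(\<lambda>n. LINT z|circle_measure. w z * v n z) \<longlonglongrightarrow> 0"
proof (rule order_tendstoI)
  note [measurable] = v(1) borel_measurable_integrable[OF w(1)]
  have vi: "integrable circle_measure (v n)" for n
    by (rule Bochner_Integration.integrable_bound[of _ "\<lambda>_. 1::real"]) (auto intro!: AE_circle simp: v(2))
  have wvi: "integrable circle_measure (\<lambda>z. w z * v n z)" for n
  proof (rule Bochner_Integration.integrable_bound[OF w(1)])
    show "AE z in circle_measure. norm (w z * v n z) \<le> norm (w z)"
      using v(2) w(2) by (intro AE_circle) (simp add: abs_mult mult_left_le)
  qed measurable
  define t where "t k z = max 0 (w z - real k)" for k :: nat and z
  have ti: "integrable circle_measure (t k)" for k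
  proof (rule Bochner_Integration.integrable_bound[OF w(1)])
    show "t k \<in> borel_measurable circle_measure" unfolding t_def by measurable
    show "AE z in circle_measure. norm (t k z) \<le> norm (w z)"
      using w(2) by (intro AE_I2) (auto simp: t_def)
  qed
  have "(\<lambda>k. LINT z|circle_measure. t k z) \<longlonglongrightarrow> (LINT z|circle_measure. 0)"
  proof (rule integral_dominated_convergence[where w = w])
    show "t k \<in> borel_measurable circle_measure" for k using ti by auto
    show "AE z in circle_measure. norm (t k z) \<le> w z" for k
      using w(2) by (intro AE_I2) (auto simp: t_def)
    have "eventually (\<lambda>k. t k z = 0) sequentially" for z
    proof -
      obtain K :: nat where "w z \<le> real K" using real_arch_simple by blast
      then show ?thesis by (intro eventually_sequentiallyI[of K]) (auto simp: t_def)
    qed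
    then show "AE z in circle_measure. (\<lambda>k. t k z) \<longlonglongrightarrow> 0"
      by (intro AE_I2 tendsto_eventually)
  qed (use w in auto)
  then have tlim: "(\<lambda>k. LINT z|circle_measure. t k z) \<longlonglongrightarrow> 0" by simp
  have le: "(LINT z|circle_measure. w z * v n z) \<le> (LINT z|circle_measure. t k z) + real k * (LINT z|circle_measure. v n z)" for n k
  proof -
    have "w z * v n z \<le> t k z + real k * v n z" if "norm z = 1" for z
    proof -
      have "w z \<le> t k z + real k" "t k z \<ge> 0" by (auto simp: t_def)
      then have "w z * v n z \<le> (t k z + real k) * v n z" "t k z * v n z \<le> t k z"
        using v(2)[OF that] by (auto intro: mult_right_mono mult_left_le)
      then show ?thesis by (simp add: distrib_right)
    qed
    then have "(LINT z|circle_measure. w z * v n z) \<le> (LINT z|circle_measure. t k z + real k * v n z)"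
      using wvi ti vi by (intro integral_mono) auto
    then show ?thesis using ti vi by simp
  qed
  fix e :: real assume e: "0 < e"
  have "eventually (\<lambda>k. (LINT z|circle_measure. t k z) < e / 2) sequentially"
    using tlim e by (intro order_tendstoD) auto
  then obtain k where k: "(LINT z|circle_measure. t k z) < e / 2"
    by (auto simp: eventually_sequentially)
  have "(\<lambda>n. real k * (LINT z|circle_measure. v n z)) \<longlonglongrightarrow> real k * 0"
    by (intro tendsto_intros lim)
  then have "eventually (\<lambda>n. real k * (LINT z|circle_measure. v n z) < e / 2) sequentially"
    using e by (intro order_tendstoD) auto
  then show "eventually (\<lambda>n. (LINT z|circle_measure. w z * v n z) < e) sequentially"
  proof eventually_elim
    case (elim n)
    then show ?case using le[of n k] k by linarith
  qed
next
  fix e :: real assume e: "e < 0"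
  have "0 \<le> (LINT z|circle_measure. w z * v n z)" for n
    using v(2) w(2) by (intro integral_nonneg_AE AE_circle) simp
  then show "eventually (\<lambda>n. (LINT z|circle_measure. w z * v n z) > e) sequentially"
    using e by (intro always_eventually allI) (rule less_le_trans)
qed

text \<open>Cesaro mean of monomials along a selection \<open>m\<close> of exponents. It serves both
  limit theorems on single powers \<open>z ^ n\<close>: average over the exponents where the claim
  would fail, and use that the means tend to 0 in norm.\<close>

definition power_mean :: "(nat \<Rightarrow> nat) \<Rightarrow> nat \<Rightarrow> complex \<Rightarrow> complex" where
  "power_mean m n z = (\<Sum>j<n. z ^ m j) / of_nat n"

lemma borel_measurable_power_mean [measurable]: "power_mean m n \<in> borel_measurable circle_measure"
  unfolding power_mean_def by (intro borel_measurable_circle) measurable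

lemma norm_power_mean_le: "norm z = 1 \<Longrightarrow> norm (power_mean m n z) \<le> 1"
proof -
  assume z: "norm z = 1"
  have "norm (\<Sum>j<n. z ^ m j) \<le> (\<Sum>j<n. norm (z ^ m j))" by (rule norm_sum)
  then show ?thesis using z by (auto simp: power_mean_def norm_divide norm_power divide_le_eq_1)
qed

text \<open>Powers of \<open>z\<close> are orthonormal and \<open>m\<close> is injective, so only
  the \<open>n\<close> diagonal terms of the \<open>n * n\<close> products survive. For
  \<open>n = 0\<close> both sides are 0, as division by 0 gives 0.\<close>

lemma integral_norm_power_mean_sq:
  assumes m: "inj m"
  shows "(LINT z|circle_measure. (norm (power_mean m n z))\<^sup>2) = 1 / real n"
proof -
  have int: "integrable circle_measure (\<lambda>z. z powi k)" for k
    using integrable_powi_mult[of "\<lambda>_. 1" k] by simp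
  have "complex_of_real ((norm (power_mean m n z))\<^sup>2) = (\<Sum>j<n. \<Sum>k<n. z powi (int (m j) - int (m k))) / of_nat (n * n)"
    if "norm z = 1" for z
  proof -
    have "z \<noteq> 0" using that by auto
    have "cnj z = inverse z" using that by (simp add: inverse_complex_def complex_eq_iff cmod_def)
    then have "cnj (z ^ k) = inverse (z ^ k)" for k by (simp add: power_inverse)
    then have "z ^ j * cnj (z ^ k) = z powi (int j - int k)" for j k
      using \<open>z \<noteq> 0\<close> by (simp add: power_int_diff divide_inverse)
    moreover have "complex_of_real ((norm (power_mean m n z))\<^sup>2) = power_mean m n z * cnj (power_mean m n z)"
      by (rule complex_norm_square)
    ultimately show ?thesis
      by (simp add: power_mean_def sum_product)
  qed
  then have "complex_of_real (LINT z|circle_measure. (norm (power_mean m n z))\<^sup>2) =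
      (LINT z|circle_measure. (\<Sum>j<n. \<Sum>k<n. z powi (int (m j) - int (m k))) / of_nat (n * n))"
    unfolding integral_complex_of_real[symmetric] by (intro Bochner_Integration.integral_cong) auto
  also have "\<dots> = (\<Sum>j<n. \<Sum>k<n. LINT z|circle_measure. z powi (int (m j) - int (m k))) / of_nat (n * n)"
    using int by simp
  also have "\<dots> = (\<Sum>j<n. \<Sum>k<n. if j = k then 1 else 0) / of_nat (n * n)"
    using m by (simp add: circle_integral_powi inj_eq)
  also have "\<dots> = complex_of_real (1 / real n)" by simp
  finally show ?thesis by (simp only: of_real_eq_iff)
qed

lemma integral_norm_power_mean_tendsto_0:
  assumes m: "inj m"
  shows "(\<lambda>n. LINT z|circle_measure. norm (power_mean m n z)) \<longlonglongrightarrow> 0"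
proof (rule tendsto_sandwich[where f = "\<lambda>_. 0" and h = "\<lambda>n. 1 / sqrt (real n)"])
  have bd: "integrable circle_measure g" if "g \<in> borel_measurable circle_measure" "\<And>z. norm z = 1 \<Longrightarrow> norm (g z) \<le> 1" for g :: "complex \<Rightarrow> real"
    using that by (intro Bochner_Integration.integrable_bound[of _ "\<lambda>_. 1::real" g]) (auto intro!: AE_circle)
  show "eventually (\<lambda>n. (LINT z|circle_measure. norm (power_mean m n z)) \<le> 1 / sqrt (real n)) sequentially"
  proof (rule eventually_mono[OF eventually_gt_at_top[of 0]])
    fix n :: nat assume n: "0 < n"
    define s where "s = sqrt (real n)"
    have s: "s > 0" "s * s = real n" using n by (auto simp: s_def)
    \<comment> \<open>The inequality of arithmetic and geometric means stands in for Cauchy-Schwarz: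
      with \<open>s = sqrt n\<close> the two terms integrate to \<open>1 / (2 * s)\<close>
      each.\<close>
    have "x \<le> 1 / (2 * s) + s / 2 * x\<^sup>2" for x :: real
    proof -
      have "0 \<le> (s * x - 1)\<^sup>2" by simp
      then have "2 * (s * x) \<le> 1 + s * s * x\<^sup>2" by (simp add: power2_eq_square algebra_simps)
      then have "2 * (s * x) / (2 * s) \<le> (1 + s * s * x\<^sup>2) / (2 * s)" using s by (intro divide_right_mono) auto
      then show ?thesis using s(1) by (simp add: add_divide_distrib)
    qed
    moreover have i: "integrable circle_measure (\<lambda>z. (norm (power_mean m n z))\<^sup>2)"
        "integrable circle_measure (\<lambda>z. norm (power_mean m n z))"
      by (intro bd; auto simp: norm_power_mean_le power_le_one)+
    ultimately have "(LINT z|circle_measure. norm (power_mean m n z)) \<le> (LINT z|circle_measure. 1 / (2 * s) + s / 2 * (norm (power_mean m n z))\<^sup>2)"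
      by (intro integral_mono) auto
    also have "\<dots> = 1 / (2 * s) + s / 2 * (1 / real n)"
      using i circle.prob_space by (simp add: integral_norm_power_mean_sq[OF m])
    also have "\<dots> = 1 / s" using s by (simp flip: s(2))
    finally show "(LINT z|circle_measure. norm (power_mean m n z)) \<le> 1 / sqrt (real n)" by (simp add: s_def)
  qed
  show "(\<lambda>n. 1 / sqrt (real n)) \<longlonglongrightarrow> 0"
    by (intro tendsto_divide_0[OF tendsto_const] filterlim_at_top_imp_at_infinity
        filterlim_compose[OF sqrt_at_top] filterlim_real_sequentially)
  show "(\<lambda>n. 0::real) \<longlonglongrightarrow> 0" by simp
qed simp

lemma weighted_power_mean_tendsto_0:
  assumes "inj m" "integrable circle_measure w" "\<And>z. w z \<ge> 0"
  shows "(\<lambda>n. LINT z|circle_measure. w z * norm (power_mean m n z)) \<longlonglongrightarrow> 0"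
  using assms(2,3) by (rule integral_mult_tendsto_0)
    (auto simp: norm_power_mean_le intro: integral_norm_power_mean_tendsto_0 assms(1))

text \<open>On the circle \<open>norm (power_mean m n z)\<close> is at most 1, so its
  \<open>p\<close>-th power is at most itself. This reduces the claim to the weighted mean with
  weight \<open>norm (f z) powr p\<close>.\<close>

lemma Lp_norm_power_mean_mult_tendsto_0:
  assumes p: "p \<ge> 1" and m: "inj m" and f: "f \<in> Lp p"
  shows "(\<lambda>n. Lp_norm p (\<lambda>z. power_mean m n z * f z)) \<longlonglongrightarrow> 0"
proof -
  have [measurable]: "f \<in> borel_measurable circle_measure" by (rule Lp_measurable[OF f])
  define I where "I n = (LINT z|circle_measure. norm (f z) powr p * norm (power_mean m n z))" for n
  have I: "I \<longlonglongrightarrow> 0"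
    unfolding I_def by (rule weighted_power_mean_tendsto_0[OF m Lp_integrable_powr[OF f]]) simp
  have I0: "I n \<ge> 0" for n by (simp add: I_def)
  have bd: "norm (power_mean m n z * f z) powr p \<le> norm (f z) powr p * norm (power_mean m n z)" if "norm z = 1" for n z
  proof -
    have "norm (power_mean m n z) powr p \<le> norm (power_mean m n z)"
      using powr_mono'[of 1 p "norm (power_mean m n z)"] p norm_power_mean_le[OF that, of m n] by simp
    then have "norm (f z) powr p * norm (power_mean m n z) powr p \<le> norm (f z) powr p * norm (power_mean m n z)"
      by (intro mult_left_mono) auto
    then show ?thesis by (simp add: norm_mult powr_mult mult.commute)
  qed
  have le: "Lp_norm p (\<lambda>z. power_mean m n z * f z) \<le> I n powr (1 / p)" for n
    unfolding Lp_norm_def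
  proof (rule powr_mono2)
    show "(LINT z|circle_measure. norm (power_mean m n z * f z) powr p) \<le> I n"
      unfolding I_def
    proof (rule integral_mono)
      show "integrable circle_measure (\<lambda>z. norm (power_mean m n z * f z) powr p)"
        using p f by (intro Lp_integrable_powr Lp_mult_bounded[where B = 1]) (auto simp: norm_power_mean_le)
      show "integrable circle_measure (\<lambda>z. norm (f z) powr p * norm (power_mean m n z))"
      proof (rule Bochner_Integration.integrable_bound[OF Lp_integrable_powr[OF f]])
        show "AE z in circle_measure. norm (norm (f z) powr p * norm (power_mean m n z)) \<le> norm (norm (f z) powr p)"
          by (rule AE_circle) (simp add: abs_mult mult_left_le norm_power_mean_le)
      qed measurable
    qed (use bd in simp)
  qed (use p in auto)
  have "(\<lambda>n. I n powr (1 / p)) \<longlonglongrightarrow> 0 powr (1 / p)"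
    using p I0 by (intro tendsto_powr' I tendsto_const) auto
  then have "(\<lambda>n. I n powr (1 / p)) \<longlonglongrightarrow> 0" using p by simp
  then show ?thesis
    by (rule Lim_null_comparison[rotated]) (simp add: le Lp_norm_nonneg)
qed

text \<open>If the integrals stayed away from 0 with one sign along infinitely many exponents, so
  would their averages; but these are bounded by the weighted integral of
  \<open>norm (power_mean r n z)\<close>, which tends to 0.\<close>

lemma Riemann_Lebesgue_Re:
  assumes w: "integrable circle_measure w" "\<And>z. w z \<ge> 0"
  shows "(\<lambda>n. LINT z|circle_measure. w z * Re (z ^ n)) \<longlonglongrightarrow> 0"
proof -
  note [measurable] = borel_measurable_integrable[OF w(1)]
  define a where "a n = (LINT z|circle_measure. w z * Re (z ^ n))" for n
  have wm: "integrable circle_measure (\<lambda>z. w z * g z)" if "g \<in> borel_measurable circle_measure" "\<And>z. norm z = 1 \<Longrightarrow> \<bar>g z\<bar> \<le> 1" for g :: "complex \<Rightarrow> real"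
  proof (rule Bochner_Integration.integrable_bound[OF w(1)])
    show "(\<lambda>z. w z * g z) \<in> borel_measurable circle_measure" using that(1) by measurable
    show "AE z in circle_measure. norm (w z * g z) \<le> norm (w z)"
      using that(2) w(2) by (intro AE_circle) (simp add: abs_mult mult_left_le)
  qed
  have Re1: "\<bar>Re (z ^ n)\<bar> \<le> 1" if "norm z = 1" for z and n :: nat
    using abs_Re_le_cmod[of "z ^ n"] that by (simp add: norm_power)
  have Rem: "(\<lambda>z. Re (z ^ n)) \<in> borel_measurable circle_measure" for n :: nat
    by (intro borel_measurable_circle) measurable
  \<comment> \<open>The factor \<open>\<sigma>\<close> is 1 or -1 and treats both signs at
    once.\<close>
  have fin: "finite {n. \<sigma> * a n \<ge> e}" if e: "e > 0" and \<sigma>: "\<bar>\<sigma>\<bar> = 1" for e \<sigma> :: real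
  proof (rule ccontr)
    assume inf: "infinite {n. \<sigma> * a n \<ge> e}" (is "infinite ?S")
    define r where "r = enumerate ?S"
    have r: "inj r" unfolding r_def by (rule strict_mono_imp_inj_on[OF strict_mono_enumerate[OF inf]])
    have rS: "\<sigma> * a (r n) \<ge> e" for n
      using enumerate_in_set[OF inf, of n] by (simp add: r_def)
    have "e \<le> (LINT z|circle_measure. w z * norm (power_mean r n z))" if n: "n > 0" for n
    proof -
      have "real n * e = (\<Sum>j<n. e)" by simp
      also have "\<dots> \<le> (\<Sum>j<n. \<sigma> * a (r j))" using rS by (intro sum_mono)
      also have "\<dots> = (LINT z|circle_measure. (\<Sum>j<n. \<sigma> * (w z * Re (z ^ r j))))"
        unfolding a_def by (subst Bochner_Integration.integral_sum) (auto intro!: wm Rem Re1)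
      also have "\<dots> = (LINT z|circle_measure. real n * (\<sigma> * (w z * Re (power_mean r n z))))"
      proof (intro Bochner_Integration.integral_cong refl)
        fix z
        have "real n * Re (power_mean r n z) = (\<Sum>j<n. Re (z ^ r j))"
          using n by (simp add: power_mean_def Re_divide_of_nat)
        then have "real n * (\<sigma> * (w z * Re (power_mean r n z))) = \<sigma> * (w z * (\<Sum>j<n. Re (z ^ r j)))"
          by (metis mult.left_commute)
        then show "(\<Sum>j<n. \<sigma> * (w z * Re (z ^ r j))) = real n * (\<sigma> * (w z * Re (power_mean r n z)))"
          by (simp only: sum_distrib_left)
      qed
      also have "\<dots> = real n * (LINT z|circle_measure. \<sigma> * (w z * Re (power_mean r n z)))" by simp
      finally have "e \<le> (LINT z|circle_measure. \<sigma> * (w z * Re (power_mean r n z)))"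
        using n by simp
      also have "\<dots> \<le> (LINT z|circle_measure. w z * norm (power_mean r n z))"
      proof (rule integral_mono)
        show "integrable circle_measure (\<lambda>z. \<sigma> * (w z * Re (power_mean r n z)))"
          by (intro integrable_mult_right wm) (auto intro: order.trans[OF abs_Re_le_cmod norm_power_mean_le])
        show "integrable circle_measure (\<lambda>z. w z * norm (power_mean r n z))"
          by (intro wm) (auto intro: norm_power_mean_le)
        fix z
        have "\<sigma> * Re (power_mean r n z) \<le> \<bar>\<sigma> * Re (power_mean r n z)\<bar>" by (rule abs_ge_self)
        also have "\<dots> \<le> norm (power_mean r n z)" using \<sigma> by (simp add: abs_mult abs_Re_le_cmod)
        finally have "w z * (\<sigma> * Re (power_mean r n z)) \<le> w z * norm (power_mean r n z)"
          using w(2) by (intro mult_left_mono)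
        then show "\<sigma> * (w z * Re (power_mean r n z)) \<le> w z * norm (power_mean r n z)"
          by (simp add: mult.left_commute)
      qed
      finally show ?thesis .
    qed
    then have "e \<le> 0"
      by (intro LIMSEQ_le_const[OF weighted_power_mean_tendsto_0[OF r w]]) (auto intro!: exI[of _ 1])
    then show False using e by simp
  qed
  show ?thesis
    unfolding a_def[symmetric] tendsto_iff
  proof safe
    fix e :: real assume e: "e > 0"
    have "finite {n. 1 * a n \<ge> e}" "finite {n. (-1) * a n \<ge> e}" by (rule fin[OF e]; simp)+
    then have "finite ({n. 1 * a n \<ge> e} \<union> {n. (-1) * a n \<ge> e})" by simp
    moreover have "{n. \<not> dist (a n) 0 < e} \<subseteq> {n. 1 * a n \<ge> e} \<union> {n. (-1) * a n \<ge> e}" by auto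
    ultimately have "finite {n. \<not> dist (a n) 0 < e}" by (rule finite_subset[rotated])
    then show "\<forall>\<^sub>F n in sequentially. dist (a n) 0 < e"
      unfolding cofinite_eq_sequentially[symmetric] eventually_cofinite .
  qed
qed

section \<open>A perturbation inequality\<close>

lemma powr_second_order_Taylor:
  fixes q :: real
  obtains C where "C \<ge> 0"
    "\<And>u. \<bar>u\<bar> \<le> 1/2 \<Longrightarrow> \<bar>(1 + u) powr q - (1 + q * u + q * (q - 1) / 2 * u\<^sup>2)\<bar> \<le> C * \<bar>u\<bar> ^ 3"
proof
  define C where "C = \<bar>q * (q - 1) * (q - 2)\<bar> * 2 powr \<bar>q - 3\<bar> / 6"
  show "C \<ge> 0" by (simp add: C_def)
  fix u :: real assume u: "\<bar>u\<bar> \<le> 1/2"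
  define D where "D = (\<lambda>m t. (\<Prod>i<m. q - real i) * (1 + t) powr (q - real m))"
  have "\<exists>t. \<bar>t\<bar> \<le> \<bar>u\<bar> \<and> (1 + u) powr q = (\<Sum>m<3. D m 0 / fact m * u ^ m) + D 3 t / fact 3 * u ^ 3"
  proof (rule Maclaurin_bi_le)
    show "D 0 = (\<lambda>u. (1 + u) powr q)" by (simp add: D_def)
    show "\<forall>m t. m < 3 \<and> \<bar>t\<bar> \<le> \<bar>u\<bar> \<longrightarrow> (D m has_real_derivative D (Suc m) t) (at t)"
    proof safe
      fix m t assume "\<bar>t\<bar> \<le> \<bar>u\<bar>"
      then have "1 + t > 0" using u by linarith
      then show "(D m has_real_derivative D (Suc m) t) (at t)"
        unfolding D_def by (auto intro!: derivative_eq_intros simp: algebra_simps)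
    qed
  qed
  then obtain t where t: "\<bar>t\<bar> \<le> \<bar>u\<bar>"
    and e: "(1 + u) powr q = (\<Sum>m<3. D m 0 / fact m * u ^ m) + D 3 t / fact 3 * u ^ 3" by blast
  \<comment> \<open>Since \<open>1 + t\<close> lies between 1/2 and 2, its logarithm is at most
    \<open>ln 2\<close> in absolute value; this covers either sign of \<open>q - 3\<close>.\<close>
  have "(1 + t) powr (q - 3) \<le> 2 powr \<bar>q - 3\<bar>"
  proof -
    have p: "1 + t > 0" using t u by linarith
    have "ln (1 + t) \<le> ln 2" using t u by (subst ln_le_cancel_iff) auto
    moreover have "ln (1 + t) \<ge> ln (1/2)" using t u by (subst ln_le_cancel_iff) auto
    ultimately have "\<bar>ln (1 + t)\<bar> \<le> ln 2" by (simp add: ln_div)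
    then have "\<bar>q - 3\<bar> * \<bar>ln (1 + t)\<bar> \<le> \<bar>q - 3\<bar> * ln 2" by (rule mult_left_mono) simp
    then have "(q - 3) * ln (1 + t) \<le> \<bar>q - 3\<bar> * ln 2"
      by (metis abs_ge_self abs_mult order_trans)
    then show ?thesis using p by (simp add: powr_def)
  qed
  then have "\<bar>q * (q - 1) * (q - 2)\<bar> * (1 + t) powr (q - 3) / 6 \<le> C"
    unfolding C_def by (intro divide_right_mono mult_left_mono) auto
  moreover have "\<bar>D 3 t / fact 3\<bar> = \<bar>q * (q - 1) * (q - 2)\<bar> * (1 + t) powr (q - 3) / 6"
    by (simp add: D_def eval_nat_numeral abs_mult)
  ultimately have "\<bar>D 3 t / fact 3\<bar> * \<bar>u ^ 3\<bar> \<le> C * \<bar>u ^ 3\<bar>"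
    by (intro mult_right_mono) linarith+
  moreover have "(1 + u) powr q - (1 + q * u + q * (q - 1) / 2 * u\<^sup>2) = D 3 t / fact 3 * u ^ 3"
    unfolding e by (simp add: D_def eval_nat_numeral field_simps)
  ultimately show "\<bar>(1 + u) powr q - (1 + q * u + q * (q - 1) / 2 * u\<^sup>2)\<bar> \<le> C * \<bar>u\<bar> ^ 3"
    by (simp add: abs_mult power_abs)
qed

text \<open>The bound is pointwise rather than on the mean: once \<open>z ^ n\<close> is
  substituted, the terms in \<open>Re z\<close> and \<open>Re (z\<^sup>2)\<close> integrate to
  nearly 0 against any fixed nonnegative integrable weight, so that only \<open>\<delta>\<close> is
  left. Two applications of the Riemann-Lebesgue lemma then suffice.\<close>

lemma norm_powr_perturbation:
  fixes p :: real
  assumes "1 < p" "p \<noteq> 2"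
  obtains \<epsilon> t \<delta> a b :: real where "0 < \<epsilon>" "\<epsilon> < 1" "t \<noteq> 0" "0 < \<delta>"
    "\<And>z. norm z = 1 \<Longrightarrow>
      norm (of_real t + (z + of_real \<epsilon> * z\<^sup>2)) powr p
        \<le> norm (z + of_real \<epsilon> * z\<^sup>2) powr p - \<delta> + a * Re z + b * Re (z\<^sup>2)"
proof -
  \<comment> \<open>On the circle \<open>z + \<epsilon> z\<^sup>2 + s \<epsilon> = z (1 + \<epsilon> (z + s cnj z))\<close>. Up to multiples of \<open>Re z\<close> and
    \<open>Re (z\<^sup>2)\<close>, the second order term of the difference is \<open>\<epsilon>\<^sup>2 q (q s\<^sup>2 + 2 (q - 1) s)\<close>,
    which attains its minimum \<open>- \<epsilon>\<^sup>2 (1 - q)\<^sup>2\<close> at \<open>s = (1 - q) / q\<close>.\<close>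
  define q where "q = p / 2"
  define s where "s = (1 - q) / q"
  have q: "q > 1/2" "q \<noteq> 1" using assms by (auto simp: q_def)
  have qs: "q * s = 1 - q" using q by (simp add: s_def)
  have s0: "s \<noteq> 0" using q by (auto simp: s_def)
  have s1: "\<bar>s\<bar> \<le> 1" using q by (auto simp: s_def abs_le_iff field_simps)
  obtain C where C: "C \<ge> 0" and Taylor:
    "\<And>u. \<bar>u\<bar> \<le> 1/2 \<Longrightarrow> \<bar>(1 + u) powr q - (1 + q * u + q * (q - 1) / 2 * u\<^sup>2)\<bar> \<le> C * \<bar>u\<bar> ^ 3"
    using powr_second_order_Taylor by blast
  \<comment> \<open>Collects the terms of order \<open>\<epsilon> ^ 3\<close>: 100 bounds the
    quantity \<open>R\<close> below, and two Taylor remainders at arguments of size at most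
    \<open>12 * \<epsilon>\<close> give the second summand.\<close>
  define C' where "C' = 100 * \<bar>q * (q - 1) / 2\<bar> + 2 * C * 12 ^ 3"
  have C': "C' \<ge> 0" using C by (simp add: C'_def)
  \<comment> \<open>The first bound keeps \<open>12 * \<epsilon>\<close> within the range 1/2 of the
    Taylor estimate; the second makes the cubic error smaller than the gain
    \<open>\<epsilon>\<^sup>2 * (1 - q)\<^sup>2\<close>.\<close>
  define \<epsilon> where "\<epsilon> = min (1/24) ((1 - q)\<^sup>2 / (2 * C' + 1))"
  have \<epsilon>0: "0 < \<epsilon>" using q C' by (auto simp: \<epsilon>_def)
  have \<epsilon>1: "\<epsilon> \<le> 1/24" unfolding \<epsilon>_def by (rule min.cobounded1)
  have "\<epsilon> \<le> (1 - q)\<^sup>2 / (2 * C' + 1)" by (simp add: \<epsilon>_def)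
  then have "\<epsilon> * (2 * C' + 1) \<le> (1 - q)\<^sup>2" using C' by (simp add: field_simps)
  then have \<epsilon>2: "C' * \<epsilon> < (1 - q)\<^sup>2"
  proof -
    have "C' * \<epsilon> \<ge> 0" using C' \<epsilon>0 by simp
    moreover have "\<epsilon> * (2 * C' + 1) = 2 * (C' * \<epsilon>) + \<epsilon>" by (simp add: algebra_simps)
    ultimately show ?thesis using \<open>\<epsilon> * (2 * C' + 1) \<le> (1 - q)\<^sup>2\<close> \<epsilon>0 by linarith
  qed
  define \<delta> where "\<delta> = \<epsilon>\<^sup>2 * ((1 - q)\<^sup>2 - C' * \<epsilon>)"
  have \<delta>: "\<delta> > 0" using \<epsilon>0 \<epsilon>2 by (simp add: \<delta>_def)
  \<comment> \<open>In units of \<open>\<epsilon>\<^sup>2\<close> the second order terms contain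
    \<open>2 * \<beta> * x\<^sup>2\<close>, and \<open>2 * x\<^sup>2 = 1 + Re (z\<^sup>2)\<close>;
    thus \<open>\<beta>\<close> is the coefficient of \<open>Re (z\<^sup>2)\<close>.\<close>
  define \<beta> where "\<beta> = 2 * q * s + q * (q - 1) * (2 * s + s\<^sup>2)"
  show thesis
  proof
    show "0 < \<epsilon>" "\<epsilon> < 1" "s * \<epsilon> \<noteq> 0" "0 < \<delta>" using \<epsilon>0 \<epsilon>1 s0 \<delta> by auto
    fix z :: complex assume z: "norm z = 1"
    define x y where "x = Re z" and "y = Im z"
    have xy: "x\<^sup>2 + y\<^sup>2 = 1" using z by (simp add: x_def y_def norm_complex_def)
    have x1: "\<bar>x\<bar> \<le> 1" using xy zero_le_power2[of y] unfolding abs_square_le_1[symmetric] by linarith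
    have Z: "z = Complex x y" by (simp add: x_def y_def)
    \<comment> \<open>\<open>A\<close> is the squared modulus of \<open>z + s * cnj z\<close>. By
      \<open>u0\<close> and \<open>u1\<close> the squared moduli of
      \<open>1 + \<epsilon> * z\<close> and \<open>1 + \<epsilon> * (z + s * cnj z)\<close> exceed
      1; as \<open>q = p / 2\<close>, their \<open>q\<close>-th powers are the \<open>p\<close>-th
      powers of the norms.\<close>
    define A where "A = (1 + s)\<^sup>2 * x\<^sup>2 + (1 - s)\<^sup>2 * y\<^sup>2"
    define u0 where "u0 = 2 * \<epsilon> * x + \<epsilon>\<^sup>2"
    define u1 where "u1 = 2 * \<epsilon> * (1 + s) * x + \<epsilon>\<^sup>2 * A"
    have sq: "w powr p = (w\<^sup>2) powr q" if "w \<ge> 0" for w :: real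
    proof -
      have "(w\<^sup>2) powr q = (w powr 2) powr q" using that by simp
      then show ?thesis unfolding powr_powr by (simp add: q_def)
    qed
    have zc: "z * cnj z = 1" using z by (simp add: complex_norm_square[symmetric])
    have f1: "of_real (s * \<epsilon>) + (z + of_real \<epsilon> * z\<^sup>2) = z * (1 + of_real \<epsilon> * (z + of_real s * cnj z))"
      using zc by (simp add: algebra_simps power2_eq_square)
    have "(norm (1 + of_real \<epsilon> * (z + of_real s * cnj z)))\<^sup>2 = 1 + u1"
      unfolding cmod_power2 by (simp add: u1_def A_def Z power2_eq_square algebra_simps)
    then have n1: "norm (of_real (s * \<epsilon>) + (z + of_real \<epsilon> * z\<^sup>2)) powr p = (1 + u1) powr q"
      unfolding f1 by (simp add: sq norm_mult z)
    have f0: "z + of_real \<epsilon> * z\<^sup>2 = z * (1 + of_real \<epsilon> * z)"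
      by (simp add: algebra_simps power2_eq_square)
    have "(1 + \<epsilon> * x)\<^sup>2 + (\<epsilon> * y)\<^sup>2 = 1 + u0"
    proof -
      have "(1 + \<epsilon> * x)\<^sup>2 + (\<epsilon> * y)\<^sup>2 = 1 + 2 * \<epsilon> * x + \<epsilon>\<^sup>2 * (x\<^sup>2 + y\<^sup>2)"
        by (simp add: power2_eq_square algebra_simps)
      then show ?thesis by (simp add: xy u0_def)
    qed
    then have "(norm (1 + of_real \<epsilon> * z))\<^sup>2 = 1 + u0"
      unfolding cmod_power2 by (simp add: Z)
    then have n0: "norm (z + of_real \<epsilon> * z\<^sup>2) powr p = (1 + u0) powr q"
      unfolding f0 by (simp add: sq norm_mult z)
    have x2: "x\<^sup>2 \<le> 1" and y2: "y\<^sup>2 \<le> 1" "y\<^sup>2 = 1 - x\<^sup>2"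
      using xy zero_le_power2[of x] zero_le_power2[of y] by linarith+
    have sp: "(1 + s)\<^sup>2 \<le> 4" "(1 - s)\<^sup>2 \<le> 4"
      using s1 abs_le_square_iff[of "1 + s" 2] abs_le_square_iff[of "1 - s" 2] by auto
    have A0: "A \<ge> 0" by (simp add: A_def)
    have A4: "A \<le> 4"
    proof -
      have "A \<le> 4 * x\<^sup>2 + 4 * y\<^sup>2" unfolding A_def using sp by (intro add_mono mult_right_mono) auto
      then show ?thesis using xy by simp
    qed
    have sx: "\<bar>(1 + s) * x\<bar> \<le> 2"
      using mult_mono[of "\<bar>1 + s\<bar>" 2 "\<bar>x\<bar>" 1] s1 x1 by (simp add: abs_mult)
    have e2: "\<epsilon>\<^sup>2 \<le> \<epsilon>" using \<epsilon>0 \<epsilon>1 by (simp add: power2_eq_square mult_left_le)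
    have e2A: "\<epsilon>\<^sup>2 * A \<le> \<epsilon> * 4" using e2 A4 A0 \<epsilon>0 by (intro mult_mono) auto
    have ex: "\<bar>\<epsilon> * ((1 + s) * x)\<bar> \<le> \<epsilon> * 2" "\<bar>\<epsilon> * x\<bar> \<le> \<epsilon> * 1" unfolding abs_mult
      using sx x1 \<epsilon>0 by (auto simp: abs_mult intro!: mult_left_mono)
    have u1b: "\<bar>u1\<bar> \<le> 12 * \<epsilon>"
    proof -
      have "\<bar>u1\<bar> \<le> 2 * \<bar>\<epsilon> * ((1 + s) * x)\<bar> + \<bar>\<epsilon>\<^sup>2 * A\<bar>" unfolding u1_def by (simp add: mult.assoc)
      moreover have "\<bar>\<epsilon>\<^sup>2 * A\<bar> = \<epsilon>\<^sup>2 * A" using A0 by simp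
      ultimately show ?thesis using ex(1) e2A \<epsilon>0 by linarith
    qed
    have u0b: "\<bar>u0\<bar> \<le> 12 * \<epsilon>"
    proof -
      have "\<bar>u0\<bar> \<le> 2 * \<bar>\<epsilon> * x\<bar> + \<epsilon>\<^sup>2"
        using abs_triangle_ineq[of "2 * (\<epsilon> * x)" "\<epsilon>\<^sup>2"] by (simp add: u0_def mult.assoc abs_mult)
      then show ?thesis using e2 ex(2) \<epsilon>0 by linarith
    qed
    \<comment> \<open>\<open>\<epsilon> ^ 3 * R\<close> is the part of
      \<open>u1\<^sup>2 - u0\<^sup>2\<close> of order three and higher.\<close>
    define R where "R = 4 * ((1 + s) * x) * A + \<epsilon> * A\<^sup>2 - 4 * x - \<epsilon>"
    have R: "\<bar>R\<bar> \<le> 100"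
    proof -
      have "\<bar>(1 + s) * x * A\<bar> \<le> 2 * 4" unfolding abs_mult[of _ A] using sx A0 A4 by (intro mult_mono) auto
      moreover have "A\<^sup>2 \<le> 16" using A0 A4 abs_le_square_iff[of A 4] by simp
      then have "\<epsilon> * A\<^sup>2 \<le> 1/24 * 16" using \<epsilon>0 \<epsilon>1 by (intro mult_mono) auto
      moreover have "\<epsilon> * A\<^sup>2 \<ge> 0" using \<epsilon>0 by simp
      ultimately show ?thesis unfolding R_def using x1 \<epsilon>0 \<epsilon>1 unfolding abs_le_iff mult.assoc by linarith
    qed
    have d1: "u1 - u0 = 2 * \<epsilon> * s * x + \<epsilon>\<^sup>2 * (A - 1)"
      unfolding u1_def u0_def by algebra
    have d2: "u1\<^sup>2 - u0\<^sup>2 = 4 * \<epsilon>\<^sup>2 * ((1 + s)\<^sup>2 - 1) * x\<^sup>2 + \<epsilon> ^ 3 * R"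
      unfolding u1_def u0_def R_def by algebra
    have T: "C * \<bar>u\<bar> ^ 3 \<le> C * 12 ^ 3 * \<epsilon> ^ 3" if "\<bar>u\<bar> \<le> 12 * \<epsilon>" for u
    proof -
      have "\<bar>u\<bar> ^ 3 \<le> 12 ^ 3 * \<epsilon> ^ 3" using power_mono[OF that, of 3] by (simp add: power_mult_distrib)
      then show ?thesis using C by (simp only: mult.assoc) (rule mult_left_mono)
    qed
    have half: "\<bar>u1\<bar> \<le> 1/2" "\<bar>u0\<bar> \<le> 1/2" using u1b u0b \<epsilon>1 by auto
    have "(1 + u1) powr q - (1 + u0) powr q \<le>
      q * (u1 - u0) + q * (q - 1) / 2 * (u1\<^sup>2 - u0\<^sup>2) + 2 * (C * 12 ^ 3 * \<epsilon> ^ 3)"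
      using Taylor[OF half(1)] Taylor[OF half(2)] T[OF u1b] T[OF u0b]
      unfolding right_diff_distrib abs_le_iff by linarith
    moreover have "q * (q - 1) / 2 * (u1\<^sup>2 - u0\<^sup>2) = q * (q - 1) / 2 * (4 * \<epsilon>\<^sup>2 * ((1 + s)\<^sup>2 - 1) * x\<^sup>2) + \<epsilon> ^ 3 * (q * (q - 1) / 2 * R)"
      unfolding d2 by algebra
    moreover have "\<epsilon> ^ 3 * (q * (q - 1) / 2 * R) \<le> \<epsilon> ^ 3 * (\<bar>q * (q - 1) / 2\<bar> * 100)"
    proof (rule mult_left_mono)
      have "q * (q - 1) / 2 * R \<le> \<bar>q * (q - 1) / 2\<bar> * \<bar>R\<bar>" by (metis abs_ge_self abs_mult)
      also have "\<dots> \<le> \<bar>q * (q - 1) / 2\<bar> * 100" using R by (intro mult_left_mono) auto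
      finally show "q * (q - 1) / 2 * R \<le> \<bar>q * (q - 1) / 2\<bar> * 100" .
    qed (use \<epsilon>0 in simp)
    moreover have "C' * \<epsilon> ^ 3 = \<epsilon> ^ 3 * (\<bar>q * (q - 1) / 2\<bar> * 100) + 2 * (C * 12 ^ 3 * \<epsilon> ^ 3)"
      unfolding C'_def by algebra
    ultimately have m: "(1 + u1) powr q - (1 + u0) powr q \<le>
      q * (u1 - u0) + q * (q - 1) / 2 * (4 * \<epsilon>\<^sup>2 * ((1 + s)\<^sup>2 - 1) * x\<^sup>2) + C' * \<epsilon> ^ 3"
      by linarith
    have c: "Re (z\<^sup>2) = 2 * x\<^sup>2 - 1" using y2(2) by (simp add: Z power2_eq_square)
    have A': "A = (1 - s)\<^sup>2 + 4 * s * x\<^sup>2" unfolding A_def y2(2) by algebra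
    have main: "q * (u1 - u0) + q * (q - 1) / 2 * (4 * \<epsilon>\<^sup>2 * ((1 + s)\<^sup>2 - 1) * x\<^sup>2)
      = 2 * q * s * \<epsilon> * x - \<epsilon>\<^sup>2 * (1 - q)\<^sup>2 + \<epsilon>\<^sup>2 * \<beta> * Re (z\<^sup>2)"
    proof -
      have "q * (u1 - u0) + q * (q - 1) / 2 * (4 * \<epsilon>\<^sup>2 * ((1 + s)\<^sup>2 - 1) * x\<^sup>2)
          = 2 * q * s * \<epsilon> * x + \<epsilon>\<^sup>2 * (q * ((1 - s)\<^sup>2 - 1) + 2 * \<beta> * x\<^sup>2)"
        unfolding d1 A' \<beta>_def by algebra
      also have "q * ((1 - s)\<^sup>2 - 1) + 2 * \<beta> * x\<^sup>2 = (q * ((1 - s)\<^sup>2 - 1) + \<beta>) + \<beta> * Re (z\<^sup>2)"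
        unfolding c by algebra
      also have "q * ((1 - s)\<^sup>2 - 1) + \<beta> = (q * s) * (q * s) + 2 * (q - 1) * (q * s)"
        unfolding \<beta>_def by algebra
      also have "\<dots> = - (1 - q)\<^sup>2" unfolding qs by algebra
      finally show ?thesis by algebra
    qed
    have "\<delta> = \<epsilon>\<^sup>2 * (1 - q)\<^sup>2 - C' * \<epsilon> ^ 3" unfolding \<delta>_def by algebra
    then show "norm (of_real (s * \<epsilon>) + (z + of_real \<epsilon> * z\<^sup>2)) powr p
        \<le> norm (z + of_real \<epsilon> * z\<^sup>2) powr p - \<delta> + 2 * q * s * \<epsilon> * Re z + \<epsilon>\<^sup>2 * \<beta> * Re (z\<^sup>2)"
      using m[unfolded main, unfolded x_def] unfolding n0 n1 by linarith
  qed
qed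

section \<open>Compact operators on seminormed spaces\<close>

text \<open>Operators are linear only up to null vectors, as in the definition of \<open>linear_op\<close>; \<open>x \<sim> y\<close> means
  that \<open>x - y\<close> is a null vector.\<close>

locale seminormed_space = vector_space scale
  for scale :: "complex \<Rightarrow> 'v::ab_group_add \<Rightarrow> 'v" (infixr \<open>\<odot>\<close> 75) +
  fixes X :: "'v set" and N :: "'v \<Rightarrow> real"
  assumes nonempty: "X \<noteq> {}"
    and add_mem: "x \<in> X \<Longrightarrow> y \<in> X \<Longrightarrow> x + y \<in> X"
    and scale_mem: "x \<in> X \<Longrightarrow> c \<odot> x \<in> X"
    and N_triangle: "x \<in> X \<Longrightarrow> y \<in> X \<Longrightarrow> N (x + y) \<le> N x + N y"
    and N_scale: "x \<in> X \<Longrightarrow> N (c \<odot> x) = norm c * N x"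
begin

lemma zero_mem: "0 \<in> X"
  using nonempty scale_mem[of _ 0] by auto

lemma N_zero: "N 0 = 0"
  using N_scale[OF zero_mem, of 0] by simp

lemma uminus_mem: "x \<in> X \<Longrightarrow> - x \<in> X"
  using scale_mem[of x "-1"] by simp

lemma diff_mem: "x \<in> X \<Longrightarrow> y \<in> X \<Longrightarrow> x - y \<in> X"
  using add_mem[of x "-y"] uminus_mem by simp

lemma N_uminus: "x \<in> X \<Longrightarrow> N (- x) = N x"
  using N_scale[of x "-1"] by simp

lemma N_minus_commute: "x \<in> X \<Longrightarrow> y \<in> X \<Longrightarrow> N (x - y) = N (y - x)"
  using N_uminus[of "x - y"] diff_mem by simp

lemma N_diff_le: "x \<in> X \<Longrightarrow> y \<in> X \<Longrightarrow> N (x - y) \<le> N x + N y"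
  using N_triangle[of x "-y"] uminus_mem N_uminus by simp

lemma N_diff_triangle: "x \<in> X \<Longrightarrow> y \<in> X \<Longrightarrow> z \<in> X \<Longrightarrow> N (x - z) \<le> N (x - y) + N (y - z)"
  using N_triangle[of "x - y" "y - z"] diff_mem by simp

lemma N_nonneg: "x \<in> X \<Longrightarrow> N x \<ge> 0"
  using N_diff_le[of x x] N_zero by simp

lemma N_le_diff: "x \<in> X \<Longrightarrow> y \<in> X \<Longrightarrow> N x \<le> N (x - y) + N y"
  using N_triangle[of "x - y" y] diff_mem by simp

lemma N_sum: "finite I \<Longrightarrow> (\<And>i. i \<in> I \<Longrightarrow> f i \<in> X) \<Longrightarrow> (\<Sum>i\<in>I. f i) \<in> X \<and> N (\<Sum>i\<in>I. f i) \<le> (\<Sum>i\<in>I. N (f i))"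
proof (induction rule: finite_induct)
  case empty
  then show ?case by (simp add: zero_mem N_zero)
next
  case (insert i I)
  then have "f i \<in> X" "sum f I \<in> X" "N (sum f I) \<le> (\<Sum>i\<in>I. N (f i))" by auto
  then show ?case using insert.hyps N_triangle[of "f i" "sum f I"] by (simp add: add_mem)
qed

section \<open>Equality modulo null vectors and operators respecting it\<close>

definition sim :: "'v \<Rightarrow> 'v \<Rightarrow> bool" (infix \<open>\<sim>\<close> 50) where
  "x \<sim> y \<longleftrightarrow> x \<in> X \<and> y \<in> X \<and> N (x - y) = 0"

lemma sim_refl: "x \<in> X \<Longrightarrow> x \<sim> x"
  by (simp add: sim_def N_zero)

lemma sim_sym: "x \<sim> y \<Longrightarrow> y \<sim> x"
  by (auto simp: sim_def N_minus_commute)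

lemma sim_trans [trans]: "x \<sim> y \<Longrightarrow> y \<sim> z \<Longrightarrow> x \<sim> z"
  using N_diff_triangle[of x y z] N_nonneg[OF diff_mem, of x z] by (auto simp: sim_def)

lemma sim_add: "x \<sim> y \<Longrightarrow> x' \<sim> y' \<Longrightarrow> x + x' \<sim> y + y'"
  using N_triangle[of "x - y" "x' - y'"] N_nonneg[of "x + x' - (y + y')"]
  by (auto simp: sim_def add_mem diff_mem algebra_simps)

lemma sim_scale: "x \<sim> y \<Longrightarrow> c \<odot> x \<sim> c \<odot> y"
  using N_scale[of "x - y" c] by (auto simp: sim_def scale_mem diff_mem scale_right_diff_distrib)

lemma sim_diff: "x \<sim> y \<Longrightarrow> x' \<sim> y' \<Longrightarrow> x - x' \<sim> y - y'"
  using sim_add[of x y "- x'" "- y'"] sim_scale[of x' y' "-1"] by simp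

lemma sim_N: assumes "x \<sim> y" shows "N x = N y"
  using assms N_le_diff[of x y] N_le_diff[of y x] by (auto simp: sim_def N_minus_commute)

text \<open>Boundedness is included because it makes the operator respect \<open>\<sim>\<close>,
  which linearity up to null vectors does not imply.\<close>

definition linear_mod :: "('v \<Rightarrow> 'v) \<Rightarrow> bool" where
  "linear_mod F \<longleftrightarrow> (\<forall>x\<in>X. F x \<in> X) \<and> (\<forall>x\<in>X. \<forall>y\<in>X. F (x + y) \<sim> F x + F y) \<and>
     (\<forall>c. \<forall>x\<in>X. F (c \<odot> x) \<sim> c \<odot> F x) \<and> (\<exists>C. \<forall>x\<in>X. N (F x) \<le> C * N x)"

lemma linear_mod_mem: "linear_mod F \<Longrightarrow> x \<in> X \<Longrightarrow> F x \<in> X"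
  and linear_mod_add: "linear_mod F \<Longrightarrow> x \<in> X \<Longrightarrow> y \<in> X \<Longrightarrow> F (x + y) \<sim> F x + F y"
  and linear_mod_scale: "linear_mod F \<Longrightarrow> x \<in> X \<Longrightarrow> F (c \<odot> x) \<sim> c \<odot> F x"
  by (auto simp: linear_mod_def)

lemma linear_mod_diff:
  assumes "linear_mod F" "x \<in> X" "y \<in> X" shows "F (x - y) \<sim> F x - F y"
proof -
  have "F (x - y) \<sim> F x + F (- y)"
    using linear_mod_add[OF assms(1,2) uminus_mem[OF assms(3)]] by simp
  also have "F x + F (-y) \<sim> F x + (-1) \<odot> F y"
    using linear_mod_scale[OF assms(1,3), of "-1"] assms
    by (intro sim_add sim_refl linear_mod_mem[OF assms(1)]) auto
  finally show ?thesis by simp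
qed

lemma linear_mod_bounded:
  assumes "linear_mod F" obtains C where "C > 0" "\<And>x. x \<in> X \<Longrightarrow> N (F x) \<le> C * N x"
proof -
  obtain C where C: "\<And>x. x \<in> X \<Longrightarrow> N (F x) \<le> C * N x" using assms unfolding linear_mod_def by blast
  show thesis
  proof
    show "\<bar>C\<bar> + 1 > 0" by simp
    show "N (F x) \<le> (\<bar>C\<bar> + 1) * N x" if "x \<in> X" for x
      using C[OF that] N_nonneg[OF that] by (smt (verit) mult_right_mono)
  qed
qed

lemma linear_mod_sim:
  assumes F: "linear_mod F" and "x \<sim> y" shows "F x \<sim> F y"
proof -
  have xy: "x \<in> X" "y \<in> X" "N (x - y) = 0" using assms by (auto simp: sim_def)
  obtain C where "N (F (x - y)) \<le> C * N (x - y)" using linear_mod_bounded[OF F] diff_mem xy by metis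
  then have "N (F (x - y)) = 0" using xy N_nonneg linear_mod_mem[OF F] by (simp add: diff_mem order_antisym)
  then show ?thesis using sim_N[OF linear_mod_diff[OF F xy(1,2)]] linear_mod_mem[OF F] xy by (simp add: sim_def)
qed

lemma linear_mod_id: "linear_mod (\<lambda>x. x)"
  by (auto simp: linear_mod_def sim_refl add_mem scale_mem intro: exI[of _ 1])

lemma linear_mod_comp:
  assumes F: "linear_mod F" and G: "linear_mod G" shows "linear_mod (\<lambda>x. F (G x))"
  unfolding linear_mod_def
proof (intro conjI ballI allI)
  fix x y c assume x: "x \<in> X"
  show "F (G x) \<in> X" by (rule linear_mod_mem[OF F linear_mod_mem[OF G x]])
  have "F (G (c \<odot> x)) \<sim> F (c \<odot> G x)" by (rule linear_mod_sim[OF F linear_mod_scale[OF G x]])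
  also have "F (c \<odot> G x) \<sim> c \<odot> F (G x)" by (rule linear_mod_scale[OF F linear_mod_mem[OF G x]])
  finally show "F (G (c \<odot> x)) \<sim> c \<odot> F (G x)" .
  assume y: "y \<in> X"
  have "F (G (x + y)) \<sim> F (G x + G y)" by (rule linear_mod_sim[OF F linear_mod_add[OF G x y]])
  also have "F (G x + G y) \<sim> F (G x) + F (G y)" by (rule linear_mod_add[OF F linear_mod_mem[OF G x] linear_mod_mem[OF G y]])
  finally show "F (G (x + y)) \<sim> F (G x) + F (G y)" .
next
  obtain C where C: "C > 0" "\<And>x. x \<in> X \<Longrightarrow> N (F x) \<le> C * N x" using linear_mod_bounded[OF F] by metis
  obtain D where D: "D > 0" "\<And>x. x \<in> X \<Longrightarrow> N (G x) \<le> D * N x" using linear_mod_bounded[OF G] by metis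
  have "N (F (G x)) \<le> C * D * N x" if "x \<in> X" for x
    using order_trans[OF C(2)[OF linear_mod_mem[OF G that]] mult_left_mono[OF D(2)[OF that], of C]] C(1)
    by (simp add: mult.assoc)
  then show "\<exists>C. \<forall>x\<in>X. N (F (G x)) \<le> C * N x" by blast
qed

lemma linear_mod_minus:
  assumes F: "linear_mod F" and G: "linear_mod G" shows "linear_mod (\<lambda>x. F x - G x)"
  unfolding linear_mod_def
proof (intro conjI ballI allI)
  fix x y c assume x: "x \<in> X"
  show "F x - G x \<in> X" by (rule diff_mem[OF linear_mod_mem[OF F x] linear_mod_mem[OF G x]])
  show "F (c \<odot> x) - G (c \<odot> x) \<sim> c \<odot> (F x - G x)"
    unfolding scale_right_diff_distrib by (rule sim_diff[OF linear_mod_scale[OF F x] linear_mod_scale[OF G x]])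
  assume y: "y \<in> X"
  show "F (x + y) - G (x + y) \<sim> F x - G x + (F y - G y)"
    using sim_diff[OF linear_mod_add[OF F x y] linear_mod_add[OF G x y]] by (simp add: algebra_simps)
next
  obtain C where C: "C > 0" "\<And>x. x \<in> X \<Longrightarrow> N (F x) \<le> C * N x" using linear_mod_bounded[OF F] by metis
  obtain D where D: "D > 0" "\<And>x. x \<in> X \<Longrightarrow> N (G x) \<le> D * N x" using linear_mod_bounded[OF G] by metis
  have "N (F x - G x) \<le> (C + D) * N x" if "x \<in> X" for x
    using C(2)[OF that] D(2)[OF that] N_diff_le[OF linear_mod_mem[OF F that] linear_mod_mem[OF G that]]
    by (simp add: algebra_simps)
  then show "\<exists>C. \<forall>x\<in>X. N (F x - G x) \<le> C * N x" by blast
qed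

lemma linear_mod_funpow: "linear_mod F \<Longrightarrow> linear_mod (F ^^ n)"
proof (induction n)
  case (Suc n)
  then show ?case using linear_mod_comp[of F "F ^^ n"] by (simp add: comp_def)
qed (simp add: linear_mod_id id_def)

definition compact_mod :: "('v \<Rightarrow> 'v) \<Rightarrow> bool" where
  "compact_mod L \<longleftrightarrow> (\<forall>u. (\<forall>n::nat. u n \<in> X \<and> N (u n) \<le> 1) \<longrightarrow>
     (\<exists>r. \<exists>g\<in>X. strict_mono r \<and> (\<lambda>n. N (L (u (r n)) - g)) \<longlonglongrightarrow> 0))"

text \<open>Otherwise some sequence in the unit ball has images of norm larger than
  \<open>n\<close>, which no convergent subsequence allows. The hypothesis \<open>null\<close>
  covers vectors of norm 0, which cannot be normalised.\<close>

lemma compact_mod_bounded: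
  assumes mem: "\<And>x. x \<in> X \<Longrightarrow> L x \<in> X"
    and scl: "\<And>c x. x \<in> X \<Longrightarrow> L (c \<odot> x) \<sim> c \<odot> L x"
    and null: "\<And>x. x \<in> X \<Longrightarrow> N x = 0 \<Longrightarrow> N (L x) = 0"
    and L: "compact_mod L"
  shows "\<exists>C. \<forall>x\<in>X. N (L x) \<le> C * N x"
proof -
  have "\<exists>C. \<forall>x\<in>X. N x \<le> 1 \<longrightarrow> N (L x) \<le> C"
  proof (rule ccontr)
    assume "\<not> ?thesis"
    then have "\<forall>n::nat. \<exists>x. x \<in> X \<and> N x \<le> 1 \<and> N (L x) > real n" by (metis not_le)
    then obtain u where u: "\<And>n::nat. u n \<in> X \<and> N (u n) \<le> 1 \<and> N (L (u n)) > real n" by metis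
    then obtain r g where g: "g \<in> X" "strict_mono r" and lim: "(\<lambda>n. N (L (u (r n)) - g)) \<longlonglongrightarrow> 0"
      using L unfolding compact_mod_def by blast
    have "eventually (\<lambda>n. N (L (u (r n)) - g) < 1) sequentially"
      using lim by (rule order_tendstoD) simp
    moreover have "eventually (\<lambda>n::nat. real n > 1 + N g) sequentially"
      using filterlim_real_sequentially by (auto simp: filterlim_at_top_dense)
    ultimately have "eventually (\<lambda>n::nat. False) sequentially"
    proof eventually_elim
      case (elim n)
      have "real n \<le> real (r n)" using seq_suble[OF g(2)] by simp
      also have "\<dots> < N (L (u (r n)))" using u by blast
      also have "\<dots> \<le> N (L (u (r n)) - g) + N g" using N_le_diff mem u g by blast
      finally show False using elim by simp
    qed
    then show False by simp
  qed
  then obtain C where C: "\<And>x. x \<in> X \<Longrightarrow> N x \<le> 1 \<Longrightarrow> N (L x) \<le> C" by blast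
  have "N (L x) \<le> C * N x" if x: "x \<in> X" for x
  proof (cases "N x = 0")
    case False
    then have pos: "N x > 0" using N_nonneg[OF x] by simp
    have "N (L (of_real (1 / N x) \<odot> x)) \<le> C"
      using pos by (intro C scale_mem x) (simp add: N_scale x norm_divide)
    then show ?thesis
      using pos sim_N[OF scl[OF x]] by (simp add: N_scale mem x norm_divide pos_divide_le_eq)
  qed (use null x in simp)
  then show ?thesis by blast
qed

lemma compact_mod_subseq:
  assumes lin: "linear_mod L" and L: "compact_mod L"
    and u: "\<And>n. u n \<in> X" "\<And>n. N (u n) \<le> B"
  obtains r g where "strict_mono (r :: nat \<Rightarrow> nat)" "g \<in> X" "(\<lambda>n. N (L (u (r n)) - g)) \<longlonglongrightarrow> 0"
proof -
  define B' where "B' = \<bar>B\<bar> + 1"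
  have B': "B' > 0" "B \<le> B'" by (auto simp: B'_def)
  define v where "v n = of_real (1 / B') \<odot> u n" for n
  have "v n \<in> X \<and> N (v n) \<le> 1" for n
    using u(1)[of n] u(2)[of n] B' by (simp add: v_def scale_mem N_scale divide_simps norm_divide)
  then obtain r g where r: "strict_mono r" and g: "g \<in> X" and lim: "(\<lambda>n. N (L (v (r n)) - g)) \<longlonglongrightarrow> 0"
    using L unfolding compact_mod_def by metis
  have "N (L (u n) - of_real B' \<odot> g) = B' * N (L (v n) - g)" for n
  proof -
    have "of_real B' \<odot> v n = u n" using B' by (simp add: v_def flip: of_real_mult)
    then have "L (u n) \<sim> of_real B' \<odot> L (v n)"
      using linear_mod_scale[OF lin, of "v n" "of_real B'"] by (simp add: v_def scale_mem u)
    then have "L (u n) - of_real B' \<odot> g \<sim> of_real B' \<odot> L (v n) - of_real B' \<odot> g"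
      by (intro sim_diff sim_refl scale_mem g)
    from sim_N[OF this] show ?thesis
      using B' by (simp flip: scale_right_diff_distrib add: N_scale diff_mem linear_mod_mem[OF lin] v_def scale_mem u g)
  qed
  moreover have "(\<lambda>n. B' * N (L (v (r n)) - g)) \<longlonglongrightarrow> B' * 0"
    by (intro tendsto_mult lim tendsto_const)
  ultimately show thesis by (intro that[OF r scale_mem[OF g, of "of_real B'"]]) simp
qed

text \<open>F. Riesz's argument: otherwise the ranges of the powers of \<open>R = I - L\<close> decrease strictly, and the
  almost orthogonal unit vectors \<open>y n\<close> in the range of \<open>R ^^ n\<close> have images under \<open>L\<close> at mutual
  distance at least \<open>1/2\<close>. Compactness of \<open>L\<close> replaces completeness of the space.\<close>

theorem Fredholm_alternative:
  assumes lin: "linear_mod L" and L: "compact_mod L"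
    and \<eta>: "\<eta> > 0" and below: "\<And>x. x \<in> X \<Longrightarrow> \<eta> * N x \<le> N (x - L x)"
    and e: "e \<in> X"
  obtains f where "f \<in> X" "f - L f \<sim> e"
proof -
  define R where "R x = x - L x" for x
  have R: "linear_mod R" unfolding R_def by (intro linear_mod_minus linear_mod_id lin)
  have Rn: "linear_mod (R ^^ n)" for n by (intro linear_mod_funpow R)
  note memR = linear_mod_mem[OF R] and memRn = linear_mod_mem[OF Rn] and memL = linear_mod_mem[OF lin]
  have "\<exists>f\<in>X. R f \<sim> e"
  proof (rule ccontr)
    assume no: "\<not> ?thesis"
    \<comment> \<open>The range of \<open>R\<close> is closed, so \<open>e\<close> has positive
      distance from it: if \<open>R (f k)\<close> tends to \<open>e\<close>, the lower bound keeps
      \<open>f k\<close> bounded, and a subsequence of \<open>f k = R (f k) + L (f k)\<close> tends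
      to some \<open>g\<close> with \<open>R g \<sim> e\<close>.\<close>
    have "\<exists>d>0. \<forall>f\<in>X. N (e - R f) \<ge> d"
    proof (rule ccontr)
      assume "\<not> ?thesis"
      then have "\<forall>k::nat. \<exists>f\<in>X. N (e - R f) < 1 / real (Suc k)" by (metis not_le of_nat_0_less_iff zero_less_Suc zero_less_divide_1_iff)
      then obtain f where f: "\<And>k::nat. f k \<in> X" and fe: "\<And>k. N (e - R (f k)) < 1 / real (Suc k)" by metis
      have lim1: "(\<lambda>k. N (e - R (f k))) \<longlonglongrightarrow> 0"
      proof (rule tendsto_sandwich[OF _ _ tendsto_const LIMSEQ_inverse_real_of_nat])
        show "\<forall>\<^sub>F k in sequentially. 0 \<le> N (e - R (f k))"
          by (intro always_eventually allI N_nonneg diff_mem e memR f)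
        show "\<forall>\<^sub>F k in sequentially. N (e - R (f k)) \<le> inverse (real (Suc k))"
          unfolding inverse_eq_divide by (intro always_eventually allI less_imp_le[OF fe])
      qed
      have fb: "N (f k) \<le> (N e + 1) / \<eta>" for k
      proof -
        have "\<eta> * N (f k) \<le> N (R (f k))" using below f by (simp add: R_def)
        also have "\<dots> \<le> N (R (f k) - e) + N e" by (intro N_le_diff memR f e)
        also have "N (R (f k) - e) = N (e - R (f k))" by (intro N_minus_commute memR f e)
        also have "\<dots> < 1 / real (Suc k)" by (rule fe)
        also have "\<dots> \<le> 1" by simp
        finally show ?thesis using \<eta> by (simp add: field_simps)
      qed
      obtain r h where r: "strict_mono r" and h: "h \<in> X" and lim2: "(\<lambda>n. N (L (f (r n)) - h)) \<longlonglongrightarrow> 0"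
        by (rule compact_mod_subseq[OF lin L f fb])
      define g where "g = e + h"
      have g: "g \<in> X" using e h by (simp add: g_def add_mem)
      obtain C where C: "C > 0" "\<And>x. x \<in> X \<Longrightarrow> N (R x) \<le> C * N x" using linear_mod_bounded[OF R] by metis
      have lim1r: "(\<lambda>n. N (e - R (f (r n)))) \<longlonglongrightarrow> 0"
        using LIMSEQ_subseq_LIMSEQ[OF lim1 r] by (simp add: comp_def)
      have bd: "N (R g - e) \<le> C * (N (e - R (f (r n))) + N (L (f (r n)) - h)) + N (e - R (f (r n)))" for n
      proof -
        let ?f = "f (r n)"
        have "N (R g - e) \<le> N (R g - R ?f) + N (R ?f - e)" by (intro N_diff_triangle memR g f e)
        also have "N (R g - R ?f) = N (R (g - ?f))" by (rule sim_N[symmetric, OF linear_mod_diff[OF R g f]])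
        also have "\<dots> \<le> C * N (g - ?f)" by (intro C diff_mem g f)
        also have "g - ?f = (e - R ?f) - (L ?f - h)" by (simp add: g_def R_def algebra_simps)
        also have "N \<dots> \<le> N (e - R ?f) + N (L ?f - h)" by (intro N_diff_le diff_mem e memR f memL h)
        also have "N (R ?f - e) = N (e - R ?f)" by (intro N_minus_commute memR f e)
        finally show ?thesis using C(1) by (simp add: mult_left_mono)
      qed
      have "(\<lambda>n. C * (N (e - R (f (r n))) + N (L (f (r n)) - h)) + N (e - R (f (r n)))) \<longlonglongrightarrow> C * (0 + 0) + 0"
        by (intro tendsto_intros lim1r lim2)
      then have "N (R g - e) \<le> C * (0 + 0) + 0"
        by (rule LIMSEQ_le_const) (use bd in blast)
      then have "R g \<sim> e" using N_nonneg[OF diff_mem, OF memR[OF g] e] g e memR by (simp add: sim_def)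
      then show False using no g by blast
    qed
    then obtain d where d: "d > 0" "\<And>f. f \<in> X \<Longrightarrow> N (e - R f) \<ge> d" by blast
    have lower: "\<eta> ^ n * N x \<le> N ((R ^^ n) x)" if "x \<in> X" for n x
    proof (induction n)
      case (Suc n)
      have "\<eta> ^ Suc n * N x \<le> \<eta> * N ((R ^^ n) x)" using Suc \<eta> by simp
      also have "\<dots> \<le> N (R ((R ^^ n) x))" using below[OF memRn[OF that]] by (simp add: R_def)
      finally show ?case by simp
    qed simp
    \<comment> \<open>The distance \<open>D\<close> of \<open>(R ^^ n) e\<close> from the range of
      \<open>R ^^ Suc n\<close> is at least \<open>\<eta> ^ n * d\<close>. A difference of norm
      below \<open>2 * D\<close>, divided by \<open>2 * D\<close>, has norm at most 1 and distance
      at least 1/2 from that range.\<close>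
    have "\<exists>x\<in>X. N ((R ^^ n) x) \<le> 1 \<and> (\<forall>f\<in>X. N ((R ^^ n) x - (R ^^ Suc n) f) \<ge> 1/2)" for n
    proof -
      define D where "D = (INF f\<in>X. N ((R ^^ n) e - (R ^^ Suc n) f))"
      have bdd: "bdd_below ((\<lambda>f. N ((R ^^ n) e - (R ^^ Suc n) f)) ` X)"
        by (rule bdd_belowI2[where m = 0]) (intro N_nonneg diff_mem memRn e)
      have eq: "N ((R ^^ n) e - (R ^^ Suc n) f) = N ((R ^^ n) (e - R f))" if "f \<in> X" for f
        using sim_N[OF linear_mod_diff[OF Rn e memR[OF that], of n]] by (simp add: funpow_swap1)
      have "D \<ge> \<eta> ^ n * d" unfolding D_def
      proof (rule cINF_greatest[OF nonempty])
        fix f assume f: "f \<in> X"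
        have "\<eta> ^ n * d \<le> \<eta> ^ n * N (e - R f)" using d f \<eta> by simp
        also have "\<dots> \<le> N ((R ^^ n) (e - R f))" by (intro lower diff_mem e memR f)
        finally show "\<eta> ^ n * d \<le> N ((R ^^ n) e - (R ^^ Suc n) f)" using eq[OF f] by simp
      qed
      then have D: "D > 0" using d \<eta> by (smt (verit) mult_pos_pos zero_less_power)
      then have "\<exists>f\<in>X. N ((R ^^ n) e - (R ^^ Suc n) f) < 2 * D"
        using cINF_less_iff[OF nonempty bdd, of "2 * D"] unfolding D_def by simp
      then obtain f where f: "f \<in> X" "N ((R ^^ n) e - (R ^^ Suc n) f) < 2 * D" by blast
      define c where "c = complex_of_real (1 / (2 * D))"
      define x where "x = c \<odot> (e - R f)"
      have x: "x \<in> X" by (simp add: x_def scale_mem diff_mem e memR f)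
      have nc: "norm c = 1 / (2 * D)" using D by (simp add: c_def norm_divide norm_mult)
      have sx: "(R ^^ n) x \<sim> c \<odot> ((R ^^ n) e - (R ^^ Suc n) f)"
      proof -
        have "(R ^^ n) x \<sim> c \<odot> (R ^^ n) (e - R f)" unfolding x_def
          by (intro linear_mod_scale[OF Rn] diff_mem e memR f)
        also have "\<dots> \<sim> c \<odot> ((R ^^ n) e - (R ^^ n) (R f))"
          by (intro sim_scale linear_mod_diff[OF Rn] e memR f)
        finally show ?thesis by (simp add: funpow_swap1)
      qed
      have "N ((R ^^ n) x) \<le> 1"
        using sim_N[OF sx] f(2) D by (simp only: N_scale diff_mem memRn e f(1) nc) (simp add: divide_simps)
      moreover have "N ((R ^^ n) x - (R ^^ Suc n) g) \<ge> 1/2" if g: "g \<in> X" for g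
      proof -
        \<comment> \<open>Undoes the scaling by \<open>c\<close>, so that \<open>f + g'\<close>
          competes in the infimum \<open>D\<close>.\<close>
        define g' where "g' = of_real (2 * D) \<odot> g"
        have g': "g' \<in> X" by (simp add: g'_def scale_mem g)
        have "c * of_real (2 * D) = 1" using D by (simp add: c_def flip: of_real_mult)
        then have cg: "c \<odot> g' = g" by (simp add: g'_def)
        have "(R ^^ Suc n) g \<sim> c \<odot> (R ^^ Suc n) g'"
          using linear_mod_scale[OF Rn g', of "Suc n" c] unfolding cg .
        with sx have "(R ^^ n) x - (R ^^ Suc n) g \<sim> c \<odot> ((R ^^ n) e - (R ^^ Suc n) f) - c \<odot> (R ^^ Suc n) g'"
          by (rule sim_diff)
        also have "c \<odot> ((R ^^ n) e - (R ^^ Suc n) f) - c \<odot> (R ^^ Suc n) g' = c \<odot> ((R ^^ n) e - ((R ^^ Suc n) f + (R ^^ Suc n) g'))"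
          by (simp only: scale_right_diff_distrib[symmetric] diff_diff_eq)
        also have "\<dots> \<sim> c \<odot> ((R ^^ n) e - (R ^^ Suc n) (f + g'))"
          by (rule sim_scale[OF sim_diff[OF sim_refl[OF memRn[OF e]] linear_mod_add[OF Rn f(1) g', THEN sim_sym]]])
        finally have "N ((R ^^ n) x - (R ^^ Suc n) g) = 1 / (2 * D) * N ((R ^^ n) e - (R ^^ Suc n) (f + g'))"
          using sim_N by (simp only: N_scale diff_mem memRn e f g' add_mem nc)
        moreover have "D \<le> N ((R ^^ n) e - (R ^^ Suc n) (f + g'))"
          unfolding D_def by (rule cINF_lower[OF bdd add_mem[OF f(1) g']])
        ultimately show ?thesis using D by (simp only:) (simp add: divide_simps)
      qed
      ultimately show ?thesis using x by blast
    qed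
    then obtain x where x: "\<And>n. x n \<in> X" and x1: "\<And>n. N ((R ^^ n) (x n)) \<le> 1"
      and x2: "\<And>n f. f \<in> X \<Longrightarrow> N ((R ^^ n) (x n) - (R ^^ Suc n) f) \<ge> 1/2" by metis
    define y where "y n = (R ^^ n) (x n)" for n
    have y: "y n \<in> X" "N (y n) \<le> 1" for n using x x1 memRn by (auto simp: y_def)
    \<comment> \<open>\<open>L (y n) - L (y k)\<close> equals \<open>y n\<close> minus
      \<open>R (y n) + y k - R (y k)\<close>, and for \<open>k > n\<close> these three terms lie in
      the range of \<open>R ^^ Suc n\<close>.\<close>
    have sep: "N (L (y n) - L (y k)) \<ge> 1/2" if "n < k" for n k
    proof -
      define j where "j = k - Suc n"
      have k: "k = Suc n + j" using that by (simp add: j_def)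
      have yk: "y k = (R ^^ Suc n) ((R ^^ j) (x k))" unfolding y_def k funpow_add by simp
      have Ryk: "R (y k) = (R ^^ Suc n) (R ((R ^^ j) (x k)))" unfolding yk by (simp add: funpow_swap1)
      have Ryn: "R (y n) = (R ^^ Suc n) (x n)" by (simp add: y_def)
      let ?a = "(R ^^ j) (x k)"
      have "L (y n) - L (y k) = y n - ((R ^^ Suc n) (x n) + ((R ^^ Suc n) ?a - (R ^^ Suc n) (R ?a)))"
        unfolding yk[symmetric] Ryk[symmetric] Ryn[symmetric] by (simp add: R_def)
      also have "\<dots> \<sim> y n - ((R ^^ Suc n) (x n) + (R ^^ Suc n) (?a - R ?a))"
        by (rule sim_diff[OF sim_refl[OF y(1)] sim_add[OF sim_refl[OF memRn[OF x]] linear_mod_diff[OF Rn memRn[OF x] memR[OF memRn[OF x]], THEN sim_sym]]])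
      also have "\<dots> \<sim> y n - (R ^^ Suc n) (x n + (?a - R ?a))"
        by (rule sim_diff[OF sim_refl[OF y(1)] linear_mod_add[OF Rn x diff_mem[OF memRn[OF x] memR[OF memRn[OF x]]], THEN sim_sym]])
      finally have "N (L (y n) - L (y k)) = N (y n - (R ^^ Suc n) (x n + (?a - R ?a)))"
        by (rule sim_N)
      also have "\<dots> \<ge> 1/2" unfolding y_def by (intro x2 add_mem diff_mem x memRn memR)
      finally show ?thesis .
    qed
    obtain r g where r: "strict_mono (r :: nat \<Rightarrow> nat)" and g: "g \<in> X" and lim: "(\<lambda>n. N (L (y (r n)) - g)) \<longlonglongrightarrow> 0"
      using L y unfolding compact_mod_def by blast
    have "eventually (\<lambda>n. N (L (y (r n)) - g) < 1/4) sequentially"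
      using lim by (rule order_tendstoD) simp
    then obtain n where n: "N (L (y (r n)) - g) < 1/4" "N (L (y (r (Suc n))) - g) < 1/4"
      by (meson eventually_sequentially le_SucI order_refl)
    have "1/2 \<le> N (L (y (r n)) - L (y (r (Suc n))))"
      using r by (intro sep) (simp add: strict_mono_def)
    also have "\<dots> \<le> N (L (y (r n)) - g) + N (g - L (y (r (Suc n))))"
      by (intro N_diff_triangle memL y g)
    also have "N (g - L (y (r (Suc n)))) = N (L (y (r (Suc n))) - g)"
      by (intro N_minus_commute memL y g)
    finally show False using n by simp
  qed
  then show thesis using that by (auto simp: R_def)
qed

lemma sum_mem: "(\<And>i. i \<in> I \<Longrightarrow> f i \<in> X) \<Longrightarrow> (\<Sum>i\<in>I. f i) \<in> X"
  by (induction I rule: infinite_finite_induct) (auto simp: zero_mem add_mem)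

lemma linear_mod_sum:
  assumes F: "linear_mod F" and "finite I" "\<And>i. i \<in> I \<Longrightarrow> f i \<in> X"
  shows "F (\<Sum>i\<in>I. f i) \<sim> (\<Sum>i\<in>I. F (f i))"
  using assms(2,3)
proof (induction rule: finite_induct)
  case empty
  then show ?case using linear_mod_scale[OF F zero_mem, of 0] by simp
next
  case (insert i I)
  then have m: "f i \<in> X" "sum f I \<in> X" by (auto intro: sum_mem)
  have "F (f i + sum f I) \<sim> F (f i) + F (sum f I)" by (rule linear_mod_add[OF F m])
  also have "F (f i) + F (sum f I) \<sim> F (f i) + (\<Sum>i\<in>I. F (f i))"
    using insert by (intro sim_add sim_refl linear_mod_mem[OF F] m) auto
  finally show ?case using insert.hyps by simp
qed

text \<open>Norm convergence of the Cesaro means of all subsequences stands in for weak convergence, which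
  avoids the dual space.\<close>

lemma compact_mod_tendsto_0:
  assumes lin: "linear_mod L" and L: "compact_mod L"
    and u: "\<And>n. u n \<in> X" "\<And>n. N (u n) \<le> B"
    and avg: "\<And>s. strict_mono s \<Longrightarrow> (\<lambda>n. N (of_real (1 / real n) \<odot> (\<Sum>j<n. u (s j)))) \<longlonglongrightarrow> 0"
  shows "(\<lambda>n. N (L (u n))) \<longlonglongrightarrow> 0"
proof (rule ccontr)
  note memL = linear_mod_mem[OF lin]
  assume "\<not> ?thesis"
  then obtain e where e: "e > 0" and not_ev: "\<not> (\<forall>\<^sub>F n in sequentially. dist (N (L (u n))) 0 < e)"
    unfolding tendsto_iff by blast
  define S where "S = {n. N (L (u n)) \<ge> e}"
  have "infinite S"
    using not_ev N_nonneg[OF memL[OF u(1)]]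
    by (simp add: S_def not_eventually frequently_cofinite[symmetric] cofinite_eq_sequentially not_less)
  define r where "r = enumerate S"
  have r: "strict_mono r" unfolding r_def by (rule strict_mono_enumerate[OF \<open>infinite S\<close>])
  have rS: "N (L (u (r n))) \<ge> e" for n
    using enumerate_in_set[OF \<open>infinite S\<close>, of n] by (simp add: S_def r_def)
  obtain r' g where r': "strict_mono r'" and g: "g \<in> X" and lim: "(\<lambda>n. N (L (u (r (r' n))) - g)) \<longlonglongrightarrow> 0"
    by (rule compact_mod_subseq[OF lin L, of "\<lambda>n. u (r n)" B]) (use u in auto)
  have "\<forall>\<^sub>F n in sequentially. N (L (u (r (r' n))) - g) < e / 4"
    using lim e by (intro order_tendstoD) auto
  then obtain J where J: "\<And>n. n \<ge> J \<Longrightarrow> N (L (u (r (r' n))) - g) < e / 4"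
    by (auto simp: eventually_sequentially)
  \<comment> \<open>The tail from \<open>J\<close> on: every \<open>L (u (s j))\<close> is within
    \<open>e / 4\<close> of \<open>g\<close>, hence so are their averages.\<close>
  define s where "s j = r (r' (J + j))" for j
  have s: "strict_mono s" using r r' by (simp add: s_def strict_mono_def)
  define a where "a n = of_real (1 / real n) \<odot> (\<Sum>j<n. u (s j))" for n
  have a: "a n \<in> X" for n unfolding a_def by (intro scale_mem sum_mem u)
  obtain C where C: "C > 0" "\<And>x. x \<in> X \<Longrightarrow> N (L x) \<le> C * N x" using linear_mod_bounded[OF lin] by metis
  have "(\<lambda>n. N (a n)) \<longlonglongrightarrow> 0" unfolding a_def by (rule avg[OF s])
  then have "\<forall>\<^sub>F n in sequentially. N (a n) < e / (4 * C)"
    using e C by (intro order_tendstoD) auto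
  then obtain n where n: "N (a n) < e / (4 * C)" "n > 0"
    using eventually_conj[OF _ eventually_gt_at_top[of 0]] by (metis (mono_tags, lifting) eventually_happens trivial_limit_sequentially)
  have La: "L (a n) \<sim> of_real (1 / real n) \<odot> (\<Sum>j<n. L (u (s j)))"
  proof -
    have "L (a n) \<sim> of_real (1 / real n) \<odot> L (\<Sum>j<n. u (s j))"
      unfolding a_def by (intro linear_mod_scale[OF lin] sum_mem u)
    also have "\<dots> \<sim> of_real (1 / real n) \<odot> (\<Sum>j<n. L (u (s j)))"
      by (intro sim_scale linear_mod_sum[OF lin] u) auto
    finally show ?thesis .
  qed
  have "complex_of_real (1 / real n) * of_nat n = 1" using n by simp
  then have gs: "g = of_real (1 / real n) \<odot> (\<Sum>j<n. g)"
    by (simp only: sum_constant_scale scale_scale scale_one card_lessThan)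
  \<comment> \<open>The averaged images are near \<open>g\<close> and also near 0, being up to a
    null vector the image of the small \<open>a n\<close>. So \<open>N g \<le> e / 2\<close>,
    although images of norm at least \<open>e\<close> lie within \<open>e / 4\<close> of
    \<open>g\<close>.\<close>
  have "N g \<le> N (g - L (a n)) + N (L (a n))" by (intro N_le_diff g memL a)
  also have "N (g - L (a n)) = N (g - of_real (1 / real n) \<odot> (\<Sum>j<n. L (u (s j))))"
    by (intro sim_N sim_diff sim_refl g La)
  also have "g - of_real (1 / real n) \<odot> (\<Sum>j<n. L (u (s j))) = of_real (1 / real n) \<odot> (\<Sum>j<n. g - L (u (s j)))"
    by (subst (1) gs) (simp only: scale_right_diff_distrib[symmetric] sum_subtractf)
  also have "N \<dots> = 1 / real n * N (\<Sum>j<n. g - L (u (s j)))"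
    by (subst N_scale) (auto intro!: sum_mem diff_mem g memL u simp: norm_divide)
  also have "\<dots> \<le> 1 / real n * (\<Sum>j<n. e / 4)"
  proof (intro mult_left_mono)
    have "N (\<Sum>j<n. g - L (u (s j))) \<le> (\<Sum>j<n. N (g - L (u (s j))))"
      using N_sum[of "{..<n}" "\<lambda>j. g - L (u (s j))"] by (simp add: diff_mem g memL u)
    also have "\<dots> \<le> (\<Sum>j<n. e / 4)"
      using J N_minus_commute[OF g memL[OF u(1)]] by (intro sum_mono less_imp_le) (simp add: s_def)
    finally show "N (\<Sum>j<n. g - L (u (s j))) \<le> (\<Sum>j<n. e / 4)" .
  qed simp
  also have "\<dots> = e / 4" using n by simp
  also have "N (L (a n)) \<le> C * N (a n)" by (rule C(2)[OF a])
  also have "\<dots> \<le> e / 4" using n C by (simp add: field_simps)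
  finally have Ng: "N g \<le> e / 2" by simp
  have "e \<le> N (L (u (r (r' J))))" by (rule rS)
  also have "\<dots> \<le> N (L (u (r (r' J))) - g) + N g" by (intro N_le_diff memL u g)
  finally show False using Ng J[of J] e by simp
qed

end

section \<open>The shift operators on Hardy spaces\<close>

lemma sum_fun_apply: "(\<Sum>i\<in>I. F i) x = (\<Sum>i\<in>I. F i x)"
  for F :: "'i \<Rightarrow> 'b \<Rightarrow> 'c::comm_monoid_add"
  by (induction I rule: infinite_finite_induct) auto

lemma Hp_Lp: "f \<in> Hp p \<Longrightarrow> f \<in> Lp p"
  and Hp_fourier: "f \<in> Hp p \<Longrightarrow> k < 0 \<Longrightarrow> fourier f k = 0"
  by (auto simp: Hp_def)

lemma Hp_integrable: "p \<ge> 1 \<Longrightarrow> f \<in> Hp p \<Longrightarrow> integrable circle_measure f"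
  by (intro Lp_integrable Hp_Lp)

lemma Hp_add: "p \<ge> 1 \<Longrightarrow> f \<in> Hp p \<Longrightarrow> g \<in> Hp p \<Longrightarrow> (\<lambda>z. f z + g z) \<in> Hp p"
  using fourier_add[OF Hp_integrable Hp_integrable, of p f p g] by (simp add: Hp_def Lp_add)

lemma Hp_cmult: "p > 0 \<Longrightarrow> f \<in> Hp p \<Longrightarrow> (\<lambda>z. c * f z) \<in> Hp p"
  using fourier_cmult[OF Lp_measurable[OF Hp_Lp], of f p c] by (simp add: Hp_def Lp_cmult)

lemma Hp_const: "(\<lambda>z. c) \<in> Hp p"
  by (simp add: Hp_def Lp_const fourier_const)

lemma Lp_mult_powi:
  assumes "p > 0" "f \<in> Lp p" shows "(\<lambda>z. z powi m * f z) \<in> Lp p"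
  by (rule Lp_mult_bounded[OF assms, of _ 1])
    (auto simp: norm_power_int intro: borel_measurable_circle borel_measurable_power_int)

lemma Lp_norm_mult_powi: "Lp_norm p (\<lambda>z. z powi m * f z) = Lp_norm p f"
  by (rule Lp_norm_cong) (simp add: norm_mult norm_power_int)

lemma Hp_mult_power:
  assumes "p > 0" "f \<in> Hp p" shows "(\<lambda>z. z ^ n * f z) \<in> Hp p"
  using Lp_mult_powi[OF assms(1) Hp_Lp[OF assms(2)], of "int n"]
    fourier_mult_powi[OF Lp_measurable[OF Hp_Lp[OF assms(2)]], of "int n"] assms(2)
  by (auto simp: Hp_def)

lemma Lp_norm_mult_power: "Lp_norm p (\<lambda>z. z ^ n * f z) = Lp_norm p f"
  using Lp_norm_mult_powi[of p "int n" f] by simp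

lemma fourier_0_mult_power:
  assumes "p > 0" "f \<in> Hp p" "n > 0" shows "fourier (\<lambda>z. z ^ n * f z) 0 = 0"
  using fourier_mult_powi[OF Lp_measurable[OF Hp_Lp[OF assms(2)]], of "int n" 0] Hp_fourier[OF assms(2), of "- int n"] assms(3)
  by simp

lemma seminormed_space_Hp:
  assumes "p \<ge> 1"
  shows "seminormed_space (\<lambda>c f z. c * f z) (Hp p) (Lp_norm p)"
proof unfold_locales
  show "Hp p \<noteq> {}" using Hp_const by blast
  fix f g assume f: "f \<in> Hp p" and g: "g \<in> Hp p"
  show "f + g \<in> Hp p" using Hp_add[OF assms f g] by (simp add: plus_fun_def)
  show "Lp_norm p (f + g) \<le> Lp_norm p f + Lp_norm p g"
    using Lp_norm_triangle[OF assms Hp_Lp[OF f] Hp_Lp[OF g]] by (simp add: plus_fun_def)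
qed (use assms in \<open>auto simp: fun_eq_iff algebra_simps Hp_cmult Lp_norm_cmult\<close>)

text \<open>An explicit representative of the Toeplitz operator, whose own value is fixed only by a
  choice. Subtracting the mean removes the one coefficient that division by \<open>z\<close> would
  move to a negative index.\<close>

definition backward_shift :: "(complex \<Rightarrow> complex) \<Rightarrow> complex \<Rightarrow> complex" where
  "backward_shift f z = z powi (-1) * (f z - fourier f 0)"

definition forward_shift :: "(complex \<Rightarrow> complex) \<Rightarrow> complex \<Rightarrow> complex" where
  "forward_shift f z = z * f z"

context
  fixes p :: real
  assumes p: "1 \<le> p"
begin

interpretation H: seminormed_space "\<lambda>c f z. c * f z" "Hp p" "Lp_norm p"
  by (rule seminormed_space_Hp[OF p])

lemma Hp_diff: "f \<in> Hp p \<Longrightarrow> g \<in> Hp p \<Longrightarrow> (\<lambda>z. f z - g z) \<in> Hp p"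
  using H.diff_mem[of f g] by (simp add: fun_diff_def)

lemma Hp_sim_iff: "H.sim f g \<longleftrightarrow> f \<in> Hp p \<and> g \<in> Hp p \<and> (AE z in circle_measure. f z = g z)"
  using Lp_norm_eq_0_iff[of p "f - g"] p H.diff_mem[of f g] by (auto simp: H.sim_def Hp_Lp)

lemma fourier_backward_shift:
  assumes "f \<in> Hp p" shows "fourier (backward_shift f) k = fourier f (k + 1) - (if k + 1 = 0 then fourier f 0 else 0)"
proof -
  have c: "(\<lambda>z. - fourier f 0) \<in> Hp p" by (rule Hp_const)
  have m: "(\<lambda>z. f z + - fourier f 0) \<in> Hp p" by (rule Hp_add[OF p assms c])
  have "fourier (backward_shift f) k = fourier (\<lambda>z. z powi (-1) * (f z + - fourier f 0)) k"
    by (simp add: backward_shift_def[abs_def])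
  also have "\<dots> = fourier (\<lambda>z. f z + - fourier f 0) (k - (-1))"
    by (rule fourier_mult_powi[OF Lp_measurable[OF Hp_Lp[OF m]]])
  also have "\<dots> = fourier f (k - (-1)) + fourier (\<lambda>z. - fourier f 0) (k - (-1))"
    by (rule fourier_add[OF Hp_integrable[OF p assms] Hp_integrable[OF p c]])
  finally show ?thesis by (simp add: fourier_const)
qed

lemma backward_shift_Hp: assumes "f \<in> Hp p" shows "backward_shift f \<in> Hp p"
proof -
  have "(\<lambda>z. z powi (-1) * (f z - fourier f 0)) \<in> Lp p"
    using p by (intro Lp_mult_powi Hp_Lp[OF Hp_diff] Hp_const assms) auto
  then have "backward_shift f \<in> Lp p" by (simp add: backward_shift_def[abs_def])
  then show ?thesis using fourier_backward_shift[OF assms] Hp_fourier[OF assms] by (auto simp: Hp_def)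
qed

lemma linear_mod_backward_shift: "H.linear_mod backward_shift"
  unfolding H.linear_mod_def
\<comment> \<open>The bound 3 is 1 for \<open>f\<close> plus 2 for its mean.\<close>
proof (intro conjI ballI allI exI[of _ 3])
  fix f assume f: "f \<in> Hp p"
  note fm = Lp_measurable[OF Hp_Lp[OF f]]
  show B: "backward_shift f \<in> Hp p" by (rule backward_shift_Hp[OF f])
  have "backward_shift (\<lambda>z. c * f z) = (\<lambda>z. c * backward_shift f z)" for c
    by (simp add: fun_eq_iff backward_shift_def fourier_cmult[OF fm] algebra_simps)
  then show "H.sim (backward_shift (\<lambda>z. c * f z)) (\<lambda>z. c * backward_shift f z)" for c
    using H.sim_refl[OF H.scale_mem[OF B]] by simp
  have "Lp_norm p (backward_shift f) = Lp_norm p (f - (\<lambda>z. fourier f 0))"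
    unfolding backward_shift_def[abs_def] Lp_norm_mult_powi by (simp add: fun_diff_def)
  also have "\<dots> \<le> Lp_norm p f + Lp_norm p (\<lambda>z. fourier f 0)"
    by (rule H.N_diff_le[OF f Hp_const])
  also have "Lp_norm p (\<lambda>z. fourier f 0) \<le> 2 * Lp_norm p f"
    using norm_fourier_le[OF fm, of 0] Lp_integrable(2)[OF p Hp_Lp[OF f]] p by (simp add: Lp_norm_const)
  finally show "Lp_norm p (backward_shift f) \<le> 3 * Lp_norm p f" by simp
  fix g assume g: "g \<in> Hp p"
  have "backward_shift (f + g) = backward_shift f + backward_shift g"
    using fourier_add[OF Hp_integrable[OF p f] Hp_integrable[OF p g]]
    by (simp add: fun_eq_iff backward_shift_def plus_fun_def algebra_simps)
  then show "H.sim (backward_shift (f + g)) (backward_shift f + backward_shift g)"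
    using H.sim_refl[OF H.add_mem[OF B backward_shift_Hp[OF g]]] by simp
qed

lemma forward_shift_Hp: "f \<in> Hp p \<Longrightarrow> forward_shift f \<in> Hp p"
  using Hp_mult_power[of p f 1] p by (simp add: forward_shift_def[abs_def])

lemma Lp_norm_forward_shift: "Lp_norm p (forward_shift f) = Lp_norm p f"
  using Lp_norm_mult_power[of p 1 f] by (simp add: forward_shift_def[abs_def])

lemma linear_mod_forward_shift: "H.linear_mod forward_shift"
  unfolding H.linear_mod_def
proof (intro conjI ballI allI exI[of _ 1])
  fix f assume f: "f \<in> Hp p"
  show B: "forward_shift f \<in> Hp p" by (rule forward_shift_Hp[OF f])
  have "forward_shift (\<lambda>z. c * f z) = (\<lambda>z. c * forward_shift f z)" for c
    by (simp add: fun_eq_iff forward_shift_def)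
  then show "H.sim (forward_shift (\<lambda>z. c * f z)) (\<lambda>z. c * forward_shift f z)" for c
    using H.sim_refl[OF H.scale_mem[OF B]] by simp
  show "Lp_norm p (forward_shift f) \<le> 1 * Lp_norm p f" by (simp add: Lp_norm_forward_shift)
  fix g assume g: "g \<in> Hp p"
  have "forward_shift (f + g) = forward_shift f + forward_shift g"
    by (simp add: fun_eq_iff forward_shift_def distrib_left)
  then show "H.sim (forward_shift (f + g)) (forward_shift f + forward_shift g)"
    using H.sim_refl[OF H.add_mem[OF B forward_shift_Hp[OF g]]] by simp
qed

lemma backward_forward_shift: assumes "f \<in> Hp p" shows "H.sim (backward_shift (forward_shift f)) f"
proof -
  have 0: "fourier (forward_shift f) 0 = 0"
    using fourier_0_mult_power[of p f 1] p assms by (simp add: forward_shift_def[abs_def])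
  have "AE z in circle_measure. backward_shift (forward_shift f) z = f z"
  proof (rule AE_circle)
    fix z :: complex assume "norm z = 1"
    then have "z \<noteq> 0" by auto
    then show "backward_shift (forward_shift f) z = f z"
      by (simp add: backward_shift_def 0 forward_shift_def power_int_minus)
  qed
  then show ?thesis using assms by (simp add: Hp_sim_iff backward_shift_Hp forward_shift_Hp)
qed

text \<open>\<open>backward_shift f\<close> has the coefficients that
  \<open>riesz_projection\<close> asks for, so the choice there is from a nonempty set; by
  uniqueness of Fourier coefficients whatever is chosen agrees with it almost everywhere.\<close>

lemma toeplitz_e_minus_one: assumes "f \<in> Hp p" shows "H.sim (toeplitz p e_minus_one f) (backward_shift f)"
proof -
  let ?P = "\<lambda>g. g \<in> Hp p \<and> (\<forall>k\<ge>0. fourier g k = fourier (\<lambda>z. e_minus_one z * f z) k)"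
  have "fourier (\<lambda>z. e_minus_one z * f z) k = fourier f (k + 1)" for k
    using fourier_mult_powi[OF Lp_measurable[OF Hp_Lp[OF assms]], of "-1" k] by (simp add: e_minus_one_def)
  then have B: "?P (backward_shift f)"
    by (simp add: backward_shift_Hp assms fourier_backward_shift)
  then have T: "?P (toeplitz p e_minus_one f)"
    unfolding toeplitz_def riesz_projection_def by (rule someI[where P = ?P])
  have i: "integrable circle_measure (toeplitz p e_minus_one f)" "integrable circle_measure (\<lambda>z. - 1 * backward_shift f z)"
    using Hp_integrable[OF p] T Hp_cmult[of p _ "-1"] B p by auto
  have "fourier (\<lambda>z. toeplitz p e_minus_one f z + - 1 * backward_shift f z) k = 0" for k
  proof -
    have "fourier (\<lambda>z. - 1 * backward_shift f z) k = - fourier (backward_shift f) k"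
      using fourier_cmult[of "backward_shift f" "-1"] B Hp_integrable[OF p] by auto
    then show ?thesis
      using fourier_add[OF i, of k] T B Hp_fourier[of _ p k] by (cases "k \<ge> 0") auto
  qed
  then have "AE z in circle_measure. toeplitz p e_minus_one f z + - 1 * backward_shift f z = 0"
    using i by (intro fourier_eq_0_imp_AE_eq_0 Bochner_Integration.integrable_add)
  then show ?thesis using T B by (simp add: Hp_sim_iff)
qed

section \<open>Translation between \<open>linear_op\<close> and \<open>linear_mod\<close>\<close>

lemma linear_mod_imp_bounded_linear_op:
  assumes "H.linear_mod A"
  shows "bounded_linear_op (Hp p) (Lp_norm p) (Hp p) (Lp_norm p) A"
proof -
  have "Lp_norm p (\<lambda>z. A f z - A g z) = 0" if "f \<in> Hp p" "g \<in> Hp p" "Lp_norm p (\<lambda>z. f z - g z) = 0" for f g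
    using H.linear_mod_sim[OF assms, of f g] that by (simp add: H.sim_def fun_diff_def)
  then show ?thesis
    using assms unfolding bounded_linear_op_def linear_op_def H.linear_mod_def H.sim_def
    by (auto simp: fun_diff_def plus_fun_def)
qed

lemma linear_mod_toeplitz: "H.linear_mod (toeplitz p e_minus_one)"
proof -
  note T = toeplitz_e_minus_one and B = linear_mod_backward_shift
  show ?thesis
    unfolding H.linear_mod_def
  proof (intro conjI ballI allI)
    fix f c assume f: "f \<in> Hp p"
    show "toeplitz p e_minus_one f \<in> Hp p" using T[OF f] by (simp add: H.sim_def)
    show "H.sim (toeplitz p e_minus_one (\<lambda>z. c * f z)) (\<lambda>z. c * toeplitz p e_minus_one f z)"
      by (rule H.sim_trans[OF T[OF H.scale_mem[OF f]]
            H.sim_trans[OF H.linear_mod_scale[OF B f] H.sim_scale[OF H.sim_sym[OF T[OF f]]]]])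
    fix g assume g: "g \<in> Hp p"
    show "H.sim (toeplitz p e_minus_one (f + g)) (toeplitz p e_minus_one f + toeplitz p e_minus_one g)"
      by (rule H.sim_trans[OF T[OF H.add_mem[OF f g]]
            H.sim_trans[OF H.linear_mod_add[OF B f g] H.sim_add[OF H.sim_sym[OF T[OF f]] H.sim_sym[OF T[OF g]]]]])
  next
    obtain C where "\<And>f. f \<in> Hp p \<Longrightarrow> Lp_norm p (backward_shift f) \<le> C * Lp_norm p f"
      using H.linear_mod_bounded[OF B] by blast
    then show "\<exists>C. \<forall>f\<in>Hp p. Lp_norm p (toeplitz p e_minus_one f) \<le> C * Lp_norm p f"
      using H.sim_N[OF T] by auto
  qed
qed

text \<open>Compactness supplies the boundedness that \<open>linear_mod\<close> demands. That null
  functions go to null functions follows by comparing \<open>f\<close> with 0, as \<open>K\<close>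
  is well defined modulo null functions.\<close>

lemma compact_linear_op_imp:
  assumes "compact_linear_op (Hp p) (Lp_norm p) (Hp p) (Lp_norm p) K"
  shows "H.linear_mod K" "H.compact_mod K"
proof -
  have lin: "linear_op (Hp p) (Lp_norm p) (Hp p) (Lp_norm p) K" using assms by (simp add: compact_linear_op_def)
  have mem: "\<And>f. f \<in> Hp p \<Longrightarrow> K f \<in> Hp p" using lin by (simp add: linear_op_def)
  have add: "H.sim (K (f + g)) (K f + K g)" if "f \<in> Hp p" "g \<in> Hp p" for f g
  proof -
    have "Lp_norm p (\<lambda>z. K (\<lambda>z. f z + g z) z - (K f z + K g z)) = 0" using lin that by (simp add: linear_op_def)
    then show ?thesis using that H.add_mem mem by (simp add: H.sim_def fun_diff_def plus_fun_def)
  qed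
  have scl: "H.sim (K (\<lambda>z. c * f z)) (\<lambda>z. c * K f z)" if "f \<in> Hp p" for f c
  proof -
    have "Lp_norm p (\<lambda>z. K (\<lambda>z. c * f z) z - c * K f z) = 0" using lin that by (simp add: linear_op_def)
    then show ?thesis using that H.scale_mem mem by (simp add: H.sim_def fun_diff_def)
  qed
  show comp: "H.compact_mod K"
    unfolding H.compact_mod_def
    using assms by (simp add: compact_linear_op_def fun_diff_def)
  have null: "Lp_norm p (K f) = 0" if f: "f \<in> Hp p" "Lp_norm p f = 0" for f
  proof -
    have z: "(0 :: complex \<Rightarrow> complex) \<in> Hp p" by (rule H.zero_mem)
    have "Lp_norm p (\<lambda>z. f z - 0 z) = 0" using f by simp
    then have "Lp_norm p (\<lambda>z. K f z - K 0 z) = 0" using lin f z unfolding linear_op_def by blast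
    then have "H.sim (K f) (K 0)" using mem f z by (simp add: H.sim_def fun_diff_def)
    then have "Lp_norm p (K f) = Lp_norm p (K 0)" by (rule H.sim_N)
    moreover have "H.sim (K 0) 0"
      using scl[OF z, of 0] by (simp add: zero_fun_def)
    ultimately show ?thesis using H.sim_N H.N_zero by metis
  qed
  have "\<exists>C. \<forall>f\<in>Hp p. Lp_norm p (K f) \<le> C * Lp_norm p f"
    by (rule H.compact_mod_bounded[OF mem scl null comp])
  then show "H.linear_mod K" using mem add scl by (simp add: H.linear_mod_def)
qed

text \<open>\<open>B - K = B (I - S K)\<close> for the shifts \<open>B\<close>, \<open>S\<close>: were \<open>B - K\<close> bounded below, so would be
  \<open>I - S K\<close>, hence some \<open>f\<close> is mapped to \<open>1\<close> by \<open>I - S K\<close> and to \<open>B 1 = 0\<close> by \<open>B - K\<close>.\<close>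

lemma approximate_kernel:
  assumes K: "H.linear_mod K" "H.compact_mod K" and \<eta>: "\<eta> > 0"
  shows "\<exists>f\<in>Hp p. Lp_norm p f = 1 \<and> Lp_norm p (backward_shift f - K f) \<le> \<eta>"
proof (rule ccontr)
  assume no: "\<not> ?thesis"
  note B = linear_mod_backward_shift and S = linear_mod_forward_shift
  define A where "A f = backward_shift f - K f" for f
  define L where "L f = forward_shift (K f)" for f
  have A: "H.linear_mod A" unfolding A_def by (rule H.linear_mod_minus[OF B K(1)])
  have L: "H.linear_mod L" unfolding L_def by (rule H.linear_mod_comp[OF S K(1)])
  have Lc: "H.compact_mod L"
    unfolding H.compact_mod_def
  proof (intro allI impI)
    fix u :: "nat \<Rightarrow> complex \<Rightarrow> complex" assume "\<forall>n. u n \<in> Hp p \<and> Lp_norm p (u n) \<le> 1"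
    then obtain r g where r: "strict_mono r" and g: "g \<in> Hp p" and lim: "(\<lambda>n. Lp_norm p (K (u (r n)) - g)) \<longlonglongrightarrow> 0"
      using K(2) unfolding H.compact_mod_def by blast
    have "L f - forward_shift g = forward_shift (K f - g)" for f
      by (simp add: fun_eq_iff L_def forward_shift_def right_diff_distrib)
    then have "(\<lambda>n. Lp_norm p (L (u (r n)) - forward_shift g)) \<longlonglongrightarrow> 0"
      using lim by (simp add: Lp_norm_forward_shift)
    then show "\<exists>r. \<exists>g\<in>Hp p. strict_mono r \<and> (\<lambda>n. Lp_norm p (L (u (r n)) - g)) \<longlonglongrightarrow> 0"
      using r forward_shift_Hp[OF g] by blast
  qed
  \<comment> \<open>The negated claim, extended from unit vectors by homogeneity.\<close>
  have lower: "\<eta> * Lp_norm p f \<le> Lp_norm p (A f)" if f: "f \<in> Hp p" for f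
  proof (cases "Lp_norm p f = 0")
    case True
    then show ?thesis by (simp add: Lp_norm_nonneg)
  next
    case False
    then have pos: "Lp_norm p f > 0" using Lp_norm_nonneg[of p f] by simp
    define c where "c = complex_of_real (1 / Lp_norm p f)"
    have nc: "norm c = 1 / Lp_norm p f" using pos by (simp add: c_def norm_divide)
    have "Lp_norm p (\<lambda>z. c * f z) = 1" using H.N_scale[OF f, of c] nc pos by simp
    then have "\<not> Lp_norm p (A (\<lambda>z. c * f z)) \<le> \<eta>"
      using no H.scale_mem[OF f, of c] unfolding A_def by blast
    moreover have "Lp_norm p (A (\<lambda>z. c * f z)) = norm c * Lp_norm p (A f)"
      using H.sim_N[OF H.linear_mod_scale[OF A f]] H.N_scale[OF H.linear_mod_mem[OF A f]] by simp
    ultimately show ?thesis using pos nc by (simp add: field_simps)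
  qed
  have AB: "H.sim (A f) (backward_shift (f - L f))" if f: "f \<in> Hp p" for f
  proof -
    note Kf = H.linear_mod_mem[OF K(1) f] and Lf = H.linear_mod_mem[OF L f] and Bf = H.linear_mod_mem[OF B f]
    have "H.sim (backward_shift (f - L f)) (backward_shift f - backward_shift (L f))"
      by (rule H.linear_mod_diff[OF B f Lf])
    moreover have "H.sim (backward_shift f - backward_shift (L f)) (A f)"
      unfolding A_def L_def by (rule H.sim_diff[OF H.sim_refl[OF Bf] backward_forward_shift[OF Kf]])
    ultimately show ?thesis using H.sim_sym H.sim_trans by blast
  qed
  obtain C where C: "C > 0" "\<And>f. f \<in> Hp p \<Longrightarrow> Lp_norm p (backward_shift f) \<le> C * Lp_norm p f"
    using H.linear_mod_bounded[OF B] by metis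
  have below: "\<eta> / C * Lp_norm p f \<le> Lp_norm p (f - L f)" if f: "f \<in> Hp p" for f
  proof -
    have "\<eta> * Lp_norm p f \<le> Lp_norm p (A f)" by (rule lower[OF f])
    also have "\<dots> = Lp_norm p (backward_shift (f - L f))" by (rule H.sim_N[OF AB[OF f]])
    also have "\<dots> \<le> C * Lp_norm p (f - L f)" by (intro C H.diff_mem H.linear_mod_mem[OF L] f)
    finally show ?thesis using C(1) by (simp add: field_simps)
  qed
  have "\<eta> / C > 0" using \<eta> C by simp
  from H.Fredholm_alternative[OF L Lc this below Hp_const[of 1]]
  obtain f where f: "f \<in> Hp p" and fL: "H.sim (f - L f) (\<lambda>z. 1)" by metis
  have "backward_shift (\<lambda>z. 1) = 0"
    by (simp add: fun_eq_iff backward_shift_def fourier_const)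
  then have "H.sim (A f) 0" using H.sim_trans[OF AB[OF f] H.linear_mod_sim[OF B fL]] by simp
  then have "Lp_norm p (A f) = 0" using H.sim_N H.N_zero by metis
  \<comment> \<open>The lower bound for \<open>A\<close> makes \<open>f\<close> a null function,
    which contradicts that \<open>f - L f\<close> has norm 1.\<close>
  then have f0: "Lp_norm p f = 0" using lower[OF f] \<eta> Lp_norm_nonneg[of p f] by (simp add: mult_le_0_iff)
  obtain D where D: "Lp_norm p (L f) \<le> D * Lp_norm p f" using H.linear_mod_bounded[OF L] f by metis
  have "1 = Lp_norm p (f - L f)" using H.sim_N[OF fL] p by (simp add: Lp_norm_const)
  also have "\<dots> \<le> Lp_norm p f + Lp_norm p (L f)" by (intro H.N_diff_le f H.linear_mod_mem[OF L f])
  also have "\<dots> \<le> 0" using f0 D by simp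
  finally show False by simp
qed

text \<open>Averages of \<open>z ^ n * f z\<close> along any increasing sequence of exponents are
  \<open>power_mean s n z * f z\<close> and tend to 0 in norm, the substitute for weak convergence
  that compactness needs.\<close>

lemma compact_mult_power_tendsto_0:
  assumes K: "H.linear_mod K" "H.compact_mod K" and f: "f \<in> Hp p"
  shows "(\<lambda>n. Lp_norm p (K (\<lambda>z. z ^ n * f z))) \<longlonglongrightarrow> 0"
proof (rule H.compact_mod_tendsto_0[OF K])
  show "(\<lambda>z. z ^ n * f z) \<in> Hp p" for n using p by (intro Hp_mult_power f) auto
  show "Lp_norm p (\<lambda>z. z ^ n * f z) \<le> Lp_norm p f" for n by (simp add: Lp_norm_mult_power)
  fix s :: "nat \<Rightarrow> nat" assume "strict_mono s"
  then have "(\<lambda>n. Lp_norm p (\<lambda>z. power_mean s n z * f z)) \<longlonglongrightarrow> 0"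
    by (intro Lp_norm_power_mean_mult_tendsto_0 p Hp_Lp f strict_mono_imp_inj_on)
  moreover have "(\<lambda>z. power_mean s n z * f z) = (\<lambda>z. of_real (1 / real n) * (\<Sum>j<n. (\<lambda>z. z ^ s j * f z)) z)" for n
    by (simp add: fun_eq_iff sum_fun_apply power_mean_def sum_distrib_right)
  ultimately show "(\<lambda>n. Lp_norm p (\<lambda>z. of_real (1 / real n) * (\<Sum>j<n. (\<lambda>z. z ^ s j * f z)) z)) \<longlonglongrightarrow> 0"
    by simp
qed

text \<open>Both functions are multiples of \<open>f\<close>, with factors depending on
  \<open>z ^ n\<close> alone. The pointwise inequality at \<open>z ^ n\<close> is multiplied by
  \<open>norm (f z) powr p\<close> and integrated.\<close>

lemma integral_perturbation_le:
  fixes \<epsilon> t \<delta> a b :: real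
  assumes f: "f \<in> Hp p" and \<epsilon>: "0 < \<epsilon>"
    and ineq: "\<And>z. norm z = 1 \<Longrightarrow>
      norm (of_real t + (z + of_real \<epsilon> * z\<^sup>2)) powr p
        \<le> norm (z + of_real \<epsilon> * z\<^sup>2) powr p - \<delta> + a * Re z + b * Re (z\<^sup>2)"
    and u: "u = (\<lambda>z. z ^ n * f z + of_real \<epsilon> * (z ^ (2 * n) * f z))"
  shows "Lp_norm p (\<lambda>z. of_real t * f z + u z) powr p
    \<le> Lp_norm p u powr p - \<delta> * Lp_norm p f powr p
       + a * (LINT z|circle_measure. norm (f z) powr p * Re (z ^ n))
       + b * (LINT z|circle_measure. norm (f z) powr p * Re (z ^ (2 * n)))"
proof -
  have p0: "p > 0" using p by simp
  define w where "w z = norm (f z) powr p" for z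
  have wi: "integrable circle_measure w" unfolding w_def[abs_def] by (rule Lp_integrable_powr[OF Hp_Lp[OF f]])
  have wr: "integrable circle_measure (\<lambda>z. w z * Re (z ^ k))" for k
  proof (rule circle_integrable_mult_bounded[OF wi, of _ 1])
    show "(\<lambda>z. Re (z ^ k)) \<in> borel_measurable circle_measure" by (intro borel_measurable_circle) measurable
    show "norm (Re (z ^ k)) \<le> 1" if "norm z = 1" for z
      using abs_Re_le_cmod[of "z ^ k"] that by (simp add: norm_power)
  qed
  have uH: "u \<in> Hp p" unfolding u using p0 by (intro Hp_add[OF p] Hp_cmult Hp_mult_power f)
  have tuH: "(\<lambda>z. of_real t * f z + u z) \<in> Hp p" using p0 by (intro Hp_add[OF p] Hp_cmult f uH)
  have ui: "integrable circle_measure (\<lambda>z. norm (u z) powr p)" by (rule Lp_integrable_powr[OF Hp_Lp[OF uH]])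
  have "Lp_norm p (\<lambda>z. of_real t * f z + u z) powr p = (LINT z|circle_measure. norm (of_real t * f z + u z) powr p)"
    by (rule Lp_norm_powr[OF p0])
  also have "\<dots> \<le> (LINT z|circle_measure. norm (u z) powr p - \<delta> * w z + a * (w z * Re (z ^ n)) + b * (w z * Re (z ^ (2 * n))))"
  proof (rule integral_mono)
    show "integrable circle_measure (\<lambda>z. norm (of_real t * f z + u z) powr p)"
      by (rule Lp_integrable_powr[OF Hp_Lp[OF tuH]])
    show "integrable circle_measure (\<lambda>z. norm (u z) powr p - \<delta> * w z + a * (w z * Re (z ^ n)) + b * (w z * Re (z ^ (2 * n))))"
      by (intro Bochner_Integration.integrable_add Bochner_Integration.integrable_diff integrable_mult_right ui wi wr)
    fix z assume "z \<in> space circle_measure"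
    then have "norm (z ^ n) = 1" by (simp add: norm_power)
    define \<zeta> where "\<zeta> = z ^ n"
    have \<zeta>: "norm \<zeta> = 1" "\<zeta>\<^sup>2 = z ^ (2 * n)"
      using \<open>norm (z ^ n) = 1\<close> by (simp_all add: \<zeta>_def power_mult[symmetric] mult.commute)
    have e1: "of_real t * f z + u z = f z * (of_real t + (\<zeta> + of_real \<epsilon> * \<zeta>\<^sup>2))"
      and e2: "u z = f z * (\<zeta> + of_real \<epsilon> * \<zeta>\<^sup>2)"
      unfolding u \<zeta>(2) by (simp_all add: \<zeta>_def algebra_simps)
    have "w z * norm (of_real t + (\<zeta> + of_real \<epsilon> * \<zeta>\<^sup>2)) powr p
        \<le> w z * (norm (\<zeta> + of_real \<epsilon> * \<zeta>\<^sup>2) powr p - \<delta> + a * Re \<zeta> + b * Re (\<zeta>\<^sup>2))"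
      by (intro mult_left_mono ineq \<zeta>) (simp add: w_def)
    moreover have "norm (of_real t * f z + u z) powr p = w z * norm (of_real t + (\<zeta> + of_real \<epsilon> * \<zeta>\<^sup>2)) powr p"
      unfolding e1 by (simp add: norm_mult powr_mult w_def)
    moreover have "norm (u z) powr p = w z * norm (\<zeta> + of_real \<epsilon> * \<zeta>\<^sup>2) powr p"
      unfolding e2 by (simp add: norm_mult powr_mult w_def)
    ultimately show "norm (of_real t * f z + u z) powr p
        \<le> norm (u z) powr p - \<delta> * w z + a * (w z * Re (z ^ n)) + b * (w z * Re (z ^ (2 * n)))"
      unfolding \<zeta>(2) unfolding \<zeta>_def by (simp add: algebra_simps)
  qed
  also have "\<dots> = (LINT z|circle_measure. norm (u z) powr p) - \<delta> * (LINT z|circle_measure. w z)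
      + a * (LINT z|circle_measure. w z * Re (z ^ n)) + b * (LINT z|circle_measure. w z * Re (z ^ (2 * n)))"
    using ui wi wr by simp
  finally show ?thesis by (simp add: Lp_norm_powr[OF p0] w_def)
qed

text \<open>All errors are made at most \<open>e\<close> times the norm \<open>Xn\<close> of
  \<open>u\<close>, so that \<open>Xn\<close> cancels; the factor that remains beside
  \<open>C\<close> depends neither on \<open>K\<close> nor on \<open>f\<close>.\<close>

lemma compact_perturbation_bound:
  fixes \<epsilon> t \<delta> a b :: real
  assumes K: "H.linear_mod K" "H.compact_mod K"
    and \<epsilon>: "0 < \<epsilon>" "\<epsilon> \<le> 1" and \<delta>: "0 < \<delta>"
    and ineq: "\<And>z. norm z = 1 \<Longrightarrow>
      norm (of_real t + (z + of_real \<epsilon> * z\<^sup>2)) powr p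
        \<le> norm (z + of_real \<epsilon> * z\<^sup>2) powr p - \<delta> + a * Re z + b * Re (z\<^sup>2)"
    and C: "0 \<le> C" "\<And>f. f \<in> Hp p \<Longrightarrow> Lp_norm p (backward_shift f - K f) \<le> C * Lp_norm p f"
  shows "1 \<le> C * (1 - \<delta> / 2 powr (p + 1)) powr (1 / p)"
proof (rule field_le_epsilon)
  note B = linear_mod_backward_shift
  have p0: "p > 0" using p by simp
  define \<kappa> where "\<kappa> = (1 - \<delta> / 2 powr (p + 1)) powr (1 / p)"
  \<comment> \<open>A lower bound for \<open>Xn\<close>, since below
    \<open>Xn powr p - \<delta> / 2\<close> dominates the nonnegative
    \<open>Yn powr p\<close>.\<close>
  define x0 where "x0 = (\<delta> / 2) powr (1 / p)"
  have x0: "x0 > 0" using \<delta> by (simp add: x0_def)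
  fix e :: real assume e: "e > 0"
  \<comment> \<open>Two errors occur, \<open>\<bar>t\<bar> * \<eta>\<close> from the vector
    \<open>t f\<close> and \<open>\<eta>\<close> from \<open>K u\<close>; together they are
    \<open>x0 * e\<close>.\<close>
  define \<eta> where "\<eta> = x0 * e / (\<bar>t\<bar> + 1)"
  have \<eta>: "\<eta> > 0" using x0 e by (simp add: \<eta>_def)
  obtain f where f: "f \<in> Hp p" and f1: "Lp_norm p f = 1" and fker: "Lp_norm p (backward_shift f - K f) \<le> \<eta>"
    using approximate_kernel[OF K \<eta>] by blast
  define r where "r n = (LINT z|circle_measure. norm (f z) powr p * Re (z ^ n))" for n
  have r: "r \<longlonglongrightarrow> 0"
    unfolding r_def by (rule Riemann_Lebesgue_Re[OF Lp_integrable_powr[OF Hp_Lp[OF f]]]) simp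
  have dbl: "filterlim (\<lambda>n::nat. 2 * n) sequentially sequentially"
    by (rule filterlim_subseq) (simp add: strict_mono_def)
  have "(\<lambda>n. a * r n + b * r (2 * n)) \<longlonglongrightarrow> a * 0 + b * 0"
    by (intro tendsto_intros r filterlim_compose[OF r dbl])
  then have ev1: "\<forall>\<^sub>F n in sequentially. a * r n + b * r (2 * n) < \<delta> / 2"
    using \<delta> by (intro order_tendstoD) auto
  define k where "k n = Lp_norm p (K (\<lambda>z. z ^ n * f z))" for n
  have k: "k \<longlonglongrightarrow> 0" unfolding k_def by (rule compact_mult_power_tendsto_0[OF K f])
  have "(\<lambda>n. k n + \<epsilon> * k (2 * n)) \<longlonglongrightarrow> 0 + \<epsilon> * 0"
    by (intro tendsto_intros k filterlim_compose[OF k dbl])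
  then have ev2: "\<forall>\<^sub>F n in sequentially. k n + \<epsilon> * k (2 * n) < \<eta>"
    using \<eta> by (intro order_tendstoD) auto
  \<comment> \<open>With \<open>n > 0\<close> the function \<open>u\<close> has mean 0, so the
    backward shift preserves its norm.\<close>
  obtain n where n: "n > 0" "a * r n + b * r (2 * n) < \<delta> / 2" "k n + \<epsilon> * k (2 * n) < \<eta>"
    using eventually_happens[OF eventually_conj[OF eventually_gt_at_top[of 0] eventually_conj[OF ev1 ev2]]] by auto
  define u1 where "u1 = (\<lambda>z. z ^ n * f z)"
  define u2 where "u2 = (\<lambda>z. z ^ (2 * n) * f z)"
  have u12: "u1 \<in> Hp p" "u2 \<in> Hp p" unfolding u1_def u2_def by (intro Hp_mult_power p0 f)+
  have N12: "Lp_norm p u1 = 1" "Lp_norm p u2 = 1"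
    unfolding u1_def u2_def by (simp_all only: Lp_norm_mult_power f1)
  have F12: "fourier u1 0 = 0" "fourier u2 0 = 0"
    unfolding u1_def u2_def using p0 n by (auto intro!: fourier_0_mult_power f)
  define eu2 where "eu2 = (\<lambda>z. of_real \<epsilon> * u2 z)"
  have eu2: "eu2 \<in> Hp p" unfolding eu2_def by (rule H.scale_mem[OF u12(2)])
  define u where "u = u1 + eu2"
  have uH: "u \<in> Hp p" unfolding u_def by (rule H.add_mem[OF u12(1) eu2])
  define tf where "tf = (\<lambda>z. of_real t * f z)"
  have tf: "tf \<in> Hp p" unfolding tf_def by (rule H.scale_mem[OF f])
  define Xn where "Xn = Lp_norm p u"
  define Yn where "Yn = Lp_norm p (tf + u)"
  have ufun: "u = (\<lambda>z. z ^ n * f z + of_real \<epsilon> * (z ^ (2 * n) * f z))"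
    by (simp add: u_def u1_def eu2_def u2_def fun_eq_iff)
  have "Yn powr p \<le> Xn powr p - \<delta> + (a * r n + b * r (2 * n))"
    using integral_perturbation_le[OF f \<epsilon>(1) ineq ufun] f1
    by (simp add: Xn_def Yn_def r_def tf_def plus_fun_def)
  then have Yp: "Yn powr p \<le> Xn powr p - \<delta> / 2" using n(2) by simp
  have X0: "Xn \<ge> 0" "Yn \<ge> 0" by (simp_all add: Xn_def Yn_def Lp_norm_nonneg)
  have "Xn \<le> Lp_norm p u1 + Lp_norm p eu2" unfolding Xn_def u_def by (rule H.N_triangle[OF u12(1) eu2])
  also have "Lp_norm p eu2 = \<epsilon>" unfolding eu2_def using \<epsilon> by (simp add: H.N_scale[OF u12(2)] N12)
  finally have X2: "Xn \<le> 2" using N12 \<epsilon> by simp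
  have Xp: "Xn powr p \<ge> \<delta> / 2" using Yp powr_ge_zero[of Yn p] by linarith
  have "x0 \<le> (Xn powr p) powr (1 / p)" unfolding x0_def using Xp \<delta> p0 by (intro powr_mono2) auto
  then have Xx0: "x0 \<le> Xn" using X0 p0 by (simp add: powr_powr)
  \<comment> \<open>As \<open>Xn \<le> 2\<close>, the loss \<open>\<delta> / 2\<close> is at least a
    fixed fraction of \<open>Xn powr p\<close>; this is the origin of
    \<open>2 powr (p + 1)\<close>.\<close>
  have "Xn powr p * (\<delta> / 2 powr (p + 1)) \<le> 2 powr p * (\<delta> / 2 powr (p + 1))"
    using X0 X2 p0 \<delta> by (intro mult_right_mono powr_mono2) auto
  also have "\<dots> = \<delta> / 2" by (simp add: powr_add)
  finally have "Yn powr p \<le> Xn powr p * (1 - \<delta> / 2 powr (p + 1))" using Yp unfolding right_diff_distrib mult_1_right by linarith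
  then have "(Yn powr p) powr (1 / p) \<le> (Xn powr p * (1 - \<delta> / 2 powr (p + 1))) powr (1 / p)"
    using p0 by (intro powr_mono2) auto
  then have YX: "Yn \<le> Xn * \<kappa>" using X0 p0 by (simp add: powr_mult powr_powr \<kappa>_def)
  define A where "A g = backward_shift g - K g" for g
  have A: "H.linear_mod A" unfolding A_def by (rule H.linear_mod_minus[OF B K(1)])
  note Amem = H.linear_mod_mem[OF A] and Kmem = H.linear_mod_mem[OF K(1)] and Bmem = H.linear_mod_mem[OF B]
  have "fourier u 0 = 0"
    using fourier_add[OF Hp_integrable[OF p u12(1)] Hp_integrable[OF p eu2], of 0]
      fourier_cmult[OF Lp_measurable[OF Hp_Lp[OF u12(2)]], of "of_real \<epsilon>" 0] F12
    by (simp add: u_def eu2_def plus_fun_def)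
  then have "backward_shift u = (\<lambda>z. z powi (-1) * u z)"
    by (simp add: fun_eq_iff backward_shift_def)
  then have "Xn = Lp_norm p (backward_shift u)" by (simp only: Lp_norm_mult_powi Xn_def)
  also have "backward_shift u = A u + K u" by (simp add: A_def)
  also have "Lp_norm p (A u + K u) \<le> Lp_norm p (A u) + Lp_norm p (K u)"
    by (intro H.N_triangle Amem Kmem uH)
  also have "Lp_norm p (A u) \<le> C * Yn + \<bar>t\<bar> * \<eta>"
  proof -
    have "Lp_norm p (A u) = Lp_norm p ((A tf + A u) - A tf)" by simp
    also have "\<dots> \<le> Lp_norm p (A tf + A u) + Lp_norm p (A tf)"
      by (intro H.N_diff_le H.add_mem Amem tf uH)
    also have "Lp_norm p (A tf + A u) = Lp_norm p (A (tf + u))"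
      by (rule H.sim_N[OF H.linear_mod_add[OF A tf uH], symmetric])
    also have "\<dots> \<le> C * Yn" unfolding A_def Yn_def by (rule C(2)[OF H.add_mem[OF tf uH]])
    also have "Lp_norm p (A tf) = \<bar>t\<bar> * Lp_norm p (A f)"
      unfolding tf_def using H.sim_N[OF H.linear_mod_scale[OF A f]] H.N_scale[OF Amem[OF f]] by simp
    also have "\<bar>t\<bar> * Lp_norm p (A f) \<le> \<bar>t\<bar> * \<eta>" unfolding A_def by (intro mult_left_mono fker) simp
    finally show ?thesis by simp
  qed
  also have "Lp_norm p (K u) \<le> \<eta>"
  proof -
    have "Lp_norm p (K u) = Lp_norm p (K u1 + K eu2)"
      unfolding u_def by (rule H.sim_N[OF H.linear_mod_add[OF K(1) u12(1) eu2]])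
    also have "\<dots> \<le> Lp_norm p (K u1) + Lp_norm p (K eu2)" by (intro H.N_triangle Kmem u12 eu2)
    also have "Lp_norm p (K eu2) = \<epsilon> * Lp_norm p (K u2)"
      unfolding eu2_def using H.sim_N[OF H.linear_mod_scale[OF K(1) u12(2)]] H.N_scale[OF Kmem[OF u12(2)]] \<epsilon> by simp
    finally show ?thesis using n(3) by (simp add: k_def u1_def u2_def)
  qed
  finally have "Xn \<le> C * Yn + (\<bar>t\<bar> + 1) * \<eta>" by (simp add: algebra_simps)
  also have "(\<bar>t\<bar> + 1) * \<eta> = x0 * e" by (simp add: \<eta>_def)
  also have "C * Yn \<le> C * (Xn * \<kappa>)" by (intro mult_left_mono YX C)
  also have "x0 * e \<le> Xn * e" using Xx0 e by simp
  finally have "Xn * 1 \<le> Xn * (C * \<kappa> + e)" by (simp add: algebra_simps)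
  moreover have "Xn > 0" using Xx0 x0 by simp
  ultimately show "1 \<le> C * (1 - \<delta> / 2 powr (p + 1)) powr (1 / p) + e"
    unfolding \<kappa>_def by (simp only: mult_le_cancel_left_pos)
qed

text \<open>The infimum and suprema are real-valued, so they need a nonempty index set, provided by
  the zero operator, and bounded values, provided by the boundedness of \<open>A\<close>.\<close>

lemma essential_norm_bound:
  assumes bound: "\<And>K C. H.linear_mod K \<Longrightarrow> H.compact_mod K \<Longrightarrow> 0 \<le> C \<Longrightarrow>
      (\<And>f. f \<in> Hp p \<Longrightarrow> Lp_norm p (backward_shift f - K f) \<le> C * Lp_norm p f) \<Longrightarrow> c \<le> C"
  shows "c \<le> essential_norm (Hp p) (Lp_norm p) (Hp p) (Lp_norm p) (toeplitz p e_minus_one)"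
  unfolding essential_norm_def
proof (rule cINF_greatest)
  have "compact_linear_op (Hp p) (Lp_norm p) (Hp p) (Lp_norm p) (\<lambda>f z. 0)"
    using H.zero_mem H.N_zero strict_mono_id
    by (auto simp: compact_linear_op_def linear_op_def zero_fun_def intro!: exI[of _ id] bexI[of _ "\<lambda>z. 0"])
  then show "{K. compact_linear_op (Hp p) (Lp_norm p) (Hp p) (Lp_norm p) K} \<noteq> {}" by blast
  fix K assume "K \<in> {K. compact_linear_op (Hp p) (Lp_norm p) (Hp p) (Lp_norm p) K}"
  then have K: "H.linear_mod K" "H.compact_mod K" using compact_linear_op_imp by auto
  define A where "A f = toeplitz p e_minus_one f - K f" for f
  have A: "H.linear_mod A" unfolding A_def by (rule H.linear_mod_minus[OF linear_mod_toeplitz K(1)])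
  define C where "C = op_norm (Hp p) (Lp_norm p) (Lp_norm p) A"
  obtain D where D: "D > 0" "\<And>f. f \<in> Hp p \<Longrightarrow> Lp_norm p (A f) \<le> D * Lp_norm p f"
    using H.linear_mod_bounded[OF A] by metis
  have bdd: "bdd_above ((\<lambda>f. Lp_norm p (A f)) ` {f \<in> Hp p. Lp_norm p f \<le> 1})"
  proof (rule bdd_aboveI2[where M = D])
    fix f assume "f \<in> {f \<in> Hp p. Lp_norm p f \<le> 1}"
    then have "Lp_norm p (A f) \<le> D * Lp_norm p f" "D * Lp_norm p f \<le> D * 1"
      using D by (auto intro: mult_left_mono)
    then show "Lp_norm p (A f) \<le> D" by simp
  qed
  have CA: "Lp_norm p (A f) \<le> C" if "f \<in> Hp p" "Lp_norm p f \<le> 1" for f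
    unfolding C_def op_norm_def by (rule cSUP_upper[OF _ bdd]) (use that in simp)
  have "Lp_norm p (A 0) \<le> C" by (rule CA) (simp_all add: H.zero_mem H.N_zero)
  then have C0: "0 \<le> C" using Lp_norm_nonneg[of p "A 0"] by linarith
  have "Lp_norm p (backward_shift f - K f) \<le> C * Lp_norm p f" if f: "f \<in> Hp p" for f
  proof -
    have "Lp_norm p (backward_shift f - K f) = Lp_norm p (A f)"
      unfolding A_def using H.sim_N[OF H.sim_diff[OF toeplitz_e_minus_one[OF f] H.sim_refl[OF H.linear_mod_mem[OF K(1) f]]]] by simp
    also have "\<dots> \<le> C * Lp_norm p f"
    \<comment> \<open>A vector of norm 0 cannot be scaled to norm 1; for it the auxiliary bound
      \<open>D\<close> already gives 0.\<close>
    proof (cases "Lp_norm p f = 0")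
      case True
      then show ?thesis using D(2)[OF f] by simp
    next
      case False
      then have pos: "Lp_norm p f > 0" using Lp_norm_nonneg[of p f] by simp
      define s where "s = complex_of_real (1 / Lp_norm p f)"
      have ns: "norm s = 1 / Lp_norm p f" using pos by (simp add: s_def norm_divide)
      have "Lp_norm p (A (\<lambda>z. s * f z)) \<le> C"
        using pos by (intro CA H.scale_mem f) (simp add: H.N_scale[OF f] ns)
      moreover have "Lp_norm p (A (\<lambda>z. s * f z)) = norm s * Lp_norm p (A f)"
        using H.sim_N[OF H.linear_mod_scale[OF A f]] H.N_scale[OF H.linear_mod_mem[OF A f]] by simp
      ultimately show ?thesis using pos by (simp add: ns field_simps)
    qed
    finally show ?thesis .
  qed
  then have "c \<le> C" by (rule bound[OF K C0])
  then show "c \<le> op_norm (Hp p) (Lp_norm p) (Lp_norm p) (\<lambda>f y. toeplitz p e_minus_one f y - K f y)"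
    by (simp add: C_def A_def[abs_def] fun_diff_def)
qed

end

theorem mainTheorem2:
  fixes p :: real
  assumes "1 < p" and "p \<noteq> 2"
  shows "bounded_linear_op (Hp p) (Lp_norm p) (Hp p) (Lp_norm p) (toeplitz p e_minus_one)
    \<and> essential_norm (Hp p) (Lp_norm p) (Hp p) (Lp_norm p) (toeplitz p e_minus_one) > 1
    \<and> 1 = Linf_norm e_minus_one"
proof (intro conjI)
  have p: "1 \<le> p" using assms by simp
  show "bounded_linear_op (Hp p) (Lp_norm p) (Hp p) (Lp_norm p) (toeplitz p e_minus_one)"
    by (rule linear_mod_imp_bounded_linear_op[OF p linear_mod_toeplitz[OF p]])
  show "1 = Linf_norm e_minus_one" by (simp add: Linf_norm_e_minus_one)
  obtain \<epsilon> t \<delta>0 a b :: real where \<epsilon>: "0 < \<epsilon>" "\<epsilon> < 1" and \<delta>0: "0 < \<delta>0" and ineq: "\<And>z. norm z = 1 \<Longrightarrow>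
      norm (of_real t + (z + of_real \<epsilon> * z\<^sup>2)) powr p
        \<le> norm (z + of_real \<epsilon> * z\<^sup>2) powr p - \<delta>0 + a * Re z + b * Re (z\<^sup>2)"
    using norm_powr_perturbation[OF assms] by metis
  \<comment> \<open>The cap keeps the base of \<open>\<kappa>\<close> positive, and a smaller
    \<open>\<delta>\<close> only weakens the inequality.\<close>
  define \<delta> where "\<delta> = min \<delta>0 1"
  have \<delta>: "0 < \<delta>" "\<delta> \<le> 1" "\<delta> \<le> \<delta>0" using \<delta>0 by (auto simp: \<delta>_def)
  have ineq': "norm (of_real t + (z + of_real \<epsilon> * z\<^sup>2)) powr p
        \<le> norm (z + of_real \<epsilon> * z\<^sup>2) powr p - \<delta> + a * Re z + b * Re (z\<^sup>2)" if "norm z = 1" for z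
    using ineq[OF that] \<delta>(3) by linarith
  have "(2::real) powr 1 \<le> 2 powr (p + 1)" using p by (intro powr_mono) auto
  then have d: "0 < \<delta> / 2 powr (p + 1)" "\<delta> / 2 powr (p + 1) < 1" using \<delta> by (auto simp: divide_simps)
  define \<kappa> where "\<kappa> = (1 - \<delta> / 2 powr (p + 1)) powr (1 / p)"
  have \<kappa>: "0 < \<kappa>" "\<kappa> < 1"
    using d p powr_less_mono2[of "1 / p" "1 - \<delta> / 2 powr (p + 1)" 1] by (auto simp: \<kappa>_def)
  have "1 / \<kappa> \<le> essential_norm (Hp p) (Lp_norm p) (Hp p) (Lp_norm p) (toeplitz p e_minus_one)"
  proof (rule essential_norm_bound[OF p])
    fix K C assume "0 \<le> C"
      "seminormed_space.linear_mod (\<lambda>c f z. c * f z) (Hp p) (Lp_norm p) K"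
      "seminormed_space.compact_mod (Hp p) (Lp_norm p) K"
      "\<And>f. f \<in> Hp p \<Longrightarrow> Lp_norm p (backward_shift f - K f) \<le> C * Lp_norm p f"
    then have "1 \<le> C * \<kappa>"
      unfolding \<kappa>_def using \<epsilon> \<delta> ineq' by (intro compact_perturbation_bound[OF p, of K \<epsilon> \<delta> t a b C]) auto
    then show "1 / \<kappa> \<le> C" using \<kappa> by (simp add: field_simps)
  qed
  moreover have "1 < 1 / \<kappa>" using \<kappa> by simp
  ultimately show "1 < essential_norm (Hp p) (Lp_norm p) (Hp p) (Lp_norm p) (toeplitz p e_minus_one)" by linarith
qed

end
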